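(* Let $A\in\mathbb{R}^{n\times \ell}$ and $B\in\mathbb{R}^{n\times m}$ with $\operatorname{rank}(A)=r$ and $\operatorname{rank}([A\ B])=n$. Then for any fixed integer $k$ with $n-r\le k\le m-1$, there exists a subset $\mathcal{S}_0\subseteq\{1,\dots,m\}$ with $|\mathcal{S}_0|=k$ such that $[A\ B_{\mathcal{S}_0}]$ has full rank $n$ and $$\big\|([A\ B_{\mathcal{S}_0}])^{\dagger}\big\|_{\xi}^2\le \Gamma(m,n,k,r)\cdot\Big(1+\frac{\|A^{\dagger}B\|_F^2}{m-n+r}\Big)\cdot\big\|([A\ B])^{\dagger}\big\|_{\xi}^2$$ for both $\xi=2$ and $\xi=F$, where $$\Gamma(m,n,k,r)=\frac{m^2}{\big(\sqrt{(k+1)(m-n+r)}-\sqrt{(n-r)(m-k-1)}\big)^2}.$$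
   Context: For a matrix $B\in\mathbb{R}^{n\times m}$ and $\mathcal{S}\subseteq\{1,\dots,m\}$, $B_{\mathcal{S}}$ denotes the submatrix of $B$ consisting of the columns indexed by $\mathcal{S}$. $[A\ B]$ denotes horizontal concatenation. $Q^{\dagger}$ denotes the Moore–Penrose pseudoinverse, $\|\cdot\|_2$ the spectral norm and $\|\cdot\|_F$ the Frobenius norm. *)

theory Defs
  imports
    Complex_Main
    "Jordan_Normal_Form.DL_Rank"
    "Jordan_Normal_Form.DL_Submatrix"
begin

definition hconcat :: "'a::zero mat \<Rightarrow> 'a mat \<Rightarrow> 'a mat" where
  "hconcat A B =
     four_block_mat A B (0\<^sub>m 0 (dim_col A)) (0\<^sub>m 0 (dim_col B))"

text \<open>Columns are indexed from 0, as everywhere in the matrix library; the selected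
  columns keep their relative order.\<close>

definition col_submatrix :: "'a mat \<Rightarrow> nat set \<Rightarrow> 'a mat" where
  "col_submatrix B S = submatrix B UNIV S"

text \<open>The four Penrose conditions, which every real matrix satisfies for exactly one \<open>X\<close>.\<close>

definition is_pseudoinverse :: "real mat \<Rightarrow> real mat \<Rightarrow> bool" where
  "is_pseudoinverse Q X \<longleftrightarrow>
     X \<in> carrier_mat (dim_col Q) (dim_row Q) \<and>
     Q * X * Q = Q \<and>
     X * Q * X = X \<and>
     transpose_mat (Q * X) = Q * X \<and>
     transpose_mat (X * Q) = X * Q"

definition pseudoinverse :: "real mat \<Rightarrow> real mat" where
  "pseudoinverse Q = (THE X. is_pseudoinverse Q X)"

definition euclidean_norm_vec :: "real vec \<Rightarrow> real" where
  "euclidean_norm_vec v = sqrt (\<Sum>i<dim_vec v. (v $ i)\<^sup>2)"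

text \<open>The operator norm induced by the Euclidean norm. The closed unit ball is used instead of
  the unit sphere so that the supremum is over a nonempty set even for a matrix without columns.\<close>

definition spectral_norm :: "real mat \<Rightarrow> real" where
  "spectral_norm Q =
     (SUP v \<in> {v \<in> carrier_vec (dim_col Q). euclidean_norm_vec v \<le> 1}.
        euclidean_norm_vec (Q *\<^sub>v v))"

definition frobenius_norm :: "real mat \<Rightarrow> real" where
  "frobenius_norm Q = sqrt (\<Sum>i<dim_row Q. \<Sum>j<dim_col Q. (Q $$ (i, j))\<^sup>2)"

definition Gamma_bound :: "nat \<Rightarrow> nat \<Rightarrow> nat \<Rightarrow> nat \<Rightarrow> real" where
  "Gamma_bound m n k r =
     (real m)\<^sup>2 /
     (sqrt ((real k + 1) * (real m - real n + real r)) -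
      sqrt ((real n - real r) * (real m - real k - 1)))\<^sup>2"

end

theory Submission
  imports Defs
begin

text \<open>
  Put \<open>M = A A\<^sup>T + B B\<^sup>T\<close> and \<open>G = B\<^sup>T M\<^sup>-\<^sup>1 B\<close>, and let \<open>T\<close> be the complement of \<open>S\<close>. If the principal
  submatrix \<open>G\<^sub>T\<close> is at most \<open>1 - c\<close>, then \<open>A A\<^sup>T + B\<^sub>S B\<^sub>S\<^sup>T \<ge> c M\<close> in the Loewner order, and hence
  \<open>|[A B\<^sub>S]\<^sup>\<dagger> v|\<^sup>2 \<le> |[A B]\<^sup>\<dagger> v|\<^sup>2 / c\<close> for every \<open>v\<close>, which gives both norm bounds at once.

  A set \<open>T\<close> of size \<open>m - k\<close> is found by deleting indices one at a time under the barrier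
  \<open>tr ((x - G\<^sub>T)\<^sup>-\<^sup>1) \<le> \<phi>\<close>: a suitable deletion lets \<open>x\<close> decrease by (almost) \<open>1 / \<phi>\<close>, and one more such
  decrease is free at the end, so that \<open>G\<^sub>T \<le> x - (k + 1) / \<phi>\<close>. For \<open>x = 1 + w\<close> the initial barrier is at
  most \<open>N / w + (m - N) / (w + h)\<close>, where \<open>N = n - r\<close> and \<open>1 / h = 1 + |A\<^sup>\<dagger> B|\<^sub>F\<^sup>2 / (m - N)\<close>. The infimum
  over \<open>w\<close> yields exactly \<open>1 / c = \<Gamma> / h\<close>.
\<close>

subsection \<open>The barrier argument for principal submatrices\<close>

text \<open>Lowering \<open>x\<close> raises the trace and deleting an index lowers it.
  Cauchy--Schwarz between the inverses before and after the shift shows that, for some index, the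
  gain covers the loss, provided \<open>\<delta> * \<phi> < 1\<close>. This strict inequality, and
  an infimum over \<open>w\<close> that need not be attained, leave an \<epsilon> of slack. The
  slack disappears in the end because only finitely many sets \<open>T\<close> compete. The start
  \<open>x = 1 + w\<close> is natural since \<open>G\<close> is at most 1. The initial trace is
  bounded without eigenvalues: by Woodbury the inverse of \<open>x - G\<close> is an affine image of
  \<open>B\<^sup>T L\<^sup>-\<^sup>1 B\<close>, where
  \<open>L = x M - B B\<^sup>T = w B B\<^sup>T + x A A\<^sup>T\<close>. Every way of writing
  \<open>B = B U + A V\<close> then gives an upper bound. One choice is trivial
  (\<open>U = 1\<close>, \<open>V = 0\<close>); another takes for \<open>U\<close> a projection of
  rank at most \<open>N\<close> and pays for \<open>V\<close> with the pseudoinverse of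
  \<open>A\<close> times \<open>B\<close>. The best mixture of the two produces
  \<open>h\<close>.\<close>

definition quad_on :: "'i set \<Rightarrow> ('i \<Rightarrow> 'i \<Rightarrow> real) \<Rightarrow> ('i \<Rightarrow> real) \<Rightarrow> real" where
  "quad_on T H v = (\<Sum>i\<in>T. \<Sum>j\<in>T. v i * H i j * v j)"

text \<open>Forms are functions on the whole index type, restricted to \<open>T\<close>. Deleting an
  index then only shrinks \<open>T\<close>, and no matrix has to be reindexed.\<close>

definition pos_def_on :: "'i set \<Rightarrow> ('i \<Rightarrow> 'i \<Rightarrow> real) \<Rightarrow> bool" where
  "pos_def_on T H \<longleftrightarrow> (\<forall>i\<in>T. \<forall>j\<in>T. H i j = H j i) \<and>
     (\<forall>v. (\<exists>i\<in>T. v i \<noteq> 0) \<longrightarrow> 0 < quad_on T H v)"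

definition sym_inverse_on :: "'i set \<Rightarrow> ('i \<Rightarrow> 'i \<Rightarrow> real) \<Rightarrow> ('i \<Rightarrow> 'i \<Rightarrow> real) \<Rightarrow> bool" where
  "sym_inverse_on T H K \<longleftrightarrow> (\<forall>i\<in>T. \<forall>j\<in>T. K i j = K j i) \<and>
     (\<forall>i\<in>T. \<forall>j\<in>T. (\<Sum>l\<in>T. H i l * K l j) = of_bool (i = j))"

section \<open>Quadratic forms and inverses on finite index sets\<close>

lemma pos_def_on_nonneg: "pos_def_on T H \<Longrightarrow> 0 \<le> quad_on T H v"
proof (cases "\<exists>i\<in>T. v i \<noteq> 0")
  case False
  then have "quad_on T H v = 0" by (auto simp: quad_on_def intro!: sum.neutral)
  then show ?thesis by simp
qed (auto simp: pos_def_on_def less_imp_le)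

lemma quad_on_alt: "quad_on T H v = (\<Sum>i\<in>T. v i * (\<Sum>j\<in>T. H i j * v j))"
  by (simp add: quad_on_def sum_distrib_left mult.assoc)

lemma sum_of_bool_mult:
  fixes f :: "'i \<Rightarrow> real"
  assumes "finite T" "i \<in> T"
  shows "(\<Sum>l\<in>T. f l * of_bool (l = i)) = f i" "(\<Sum>l\<in>T. of_bool (l = i) * f l) = f i"
    "(\<Sum>l\<in>T. f l * of_bool (i = l)) = f i" "(\<Sum>l\<in>T. of_bool (i = l) * f l) = f i"
proof -
  have "(\<Sum>l\<in>T. f l * of_bool (l = i)) = (\<Sum>l\<in>T. if l = i then f l else 0)"
    by (rule sum.cong) auto
  then show 1: "(\<Sum>l\<in>T. f l * of_bool (l = i)) = f i" using assms by simp
  show "(\<Sum>l\<in>T. of_bool (l = i) * f l) = f i" using 1 by (simp add: mult.commute)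
  show 2: "(\<Sum>l\<in>T. f l * of_bool (i = l)) = f i" using 1 by (simp add: eq_commute[of i])
  show "(\<Sum>l\<in>T. of_bool (i = l) * f l) = f i" using 2 by (simp add: mult.commute)
qed

text \<open>The right-hand side is the value of the form \<open>H\<close> at
  \<open>z = K e\<^sub>i - s y\<close>: since \<open>H K = 1\<close>, the square of
  \<open>K e\<^sub>i\<close> contributes \<open>K i i\<close> and the cross term contributes
  \<open>y i\<close>.\<close>

lemma inverse_diag_quad_ineq:
  assumes T: "finite T" "i \<in> T" and H: "pos_def_on T H" and K: "sym_inverse_on T H K"
  shows "0 \<le> K i i - 2 * s * y i + s\<^sup>2 * quad_on T H y"
proof -
  define z where "z l = K l i - s * y l" for l
  define u where "u l = (\<Sum>j\<in>T. H l j * y j)" for l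
  have Hz: "(\<Sum>j\<in>T. H l j * z j) = of_bool (l = i) - s * u l" if "l \<in> T" for l
    using K that T
    by (simp add: z_def u_def sym_inverse_on_def algebra_simps sum_subtractf sum_distrib_left)
  have Ku: "(\<Sum>l\<in>T. K l i * u l) = y i"
  proof -
    have "(\<Sum>l\<in>T. K l i * u l) = (\<Sum>l\<in>T. \<Sum>j\<in>T. y j * (H j l * K l i))"
      unfolding u_def sum_distrib_left using H
      by (intro sum.cong refl) (auto simp: pos_def_on_def)
    also have "\<dots> = (\<Sum>j\<in>T. y j * (\<Sum>l\<in>T. H j l * K l i))"
      by (subst sum.swap) (simp add: sum_distrib_left)
    also have "\<dots> = (\<Sum>j\<in>T. y j * of_bool (j = i))"
      using K T by (intro sum.cong refl) (auto simp: sym_inverse_on_def)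
    finally show ?thesis using T by (simp add: sum_of_bool_mult)
  qed
  have yu: "(\<Sum>l\<in>T. y l * u l) = quad_on T H y" by (simp add: quad_on_alt u_def)
  have "quad_on T H z = (\<Sum>l\<in>T. z l * (of_bool (l = i) - s * u l))"
    unfolding quad_on_alt by (intro sum.cong refl) (simp add: Hz)
  also have "\<dots> = (\<Sum>l\<in>T. z l * of_bool (l = i)) - s * (\<Sum>l\<in>T. z l * u l)"
    by (simp add: algebra_simps sum_subtractf sum_distrib_left)
  also have "(\<Sum>l\<in>T. z l * of_bool (l = i)) = z i" using T by (rule sum_of_bool_mult)
  also have "(\<Sum>l\<in>T. z l * u l) = (\<Sum>l\<in>T. K l i * u l) - s * (\<Sum>l\<in>T. y l * u l)"
    unfolding z_def by (simp add: algebra_simps sum_subtractf sum_distrib_left)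
  finally have "quad_on T H z = K i i - 2 * s * y i + s\<^sup>2 * quad_on T H y"
    unfolding Ku yu by (simp add: z_def[of i] algebra_simps power2_eq_square)
  then show ?thesis using pos_def_on_nonneg[OF H, of z] by simp
qed

text \<open>The discriminant of a nonnegative quadratic in \<open>s\<close>. If \<open>c = 0\<close>
  the expression is affine in \<open>s\<close>, and a nonzero \<open>b\<close> would allow the value
  -1.\<close>

lemma square_le_of_quadratic_nonneg:
  fixes a b c :: real
  assumes "\<And>s. 0 \<le> a - 2 * s * b + s\<^sup>2 * c" and "0 \<le> c"
  shows "b\<^sup>2 \<le> a * c"
proof (cases "c = 0")
  case True
  have "b = 0"
  proof (rule ccontr)
    assume "b \<noteq> 0"
    with assms(1)[of "(a + 1) / (2 * b)"] True show False by simp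
  qed
  with True show ?thesis by simp
next
  case False
  with assms(1)[of "b / c"] assms(2) show ?thesis
    by (simp add: field_simps power2_eq_square)
qed

text \<open>Cauchy--Schwarz for the inner product \<open>tr (X\<^sup>T K Y)\<close> applied to the identity and \<open>H Y\<close>.\<close>

lemma trace_Cauchy_Schwarz:
  assumes T: "finite T" and H: "pos_def_on T H" and K: "sym_inverse_on T H K"
  shows "(\<Sum>i\<in>T. Y i i)\<^sup>2 \<le> (\<Sum>i\<in>T. K i i) * (\<Sum>i\<in>T. quad_on T H (\<lambda>l. Y l i))"
proof (rule square_le_of_quadratic_nonneg)
  fix s
  have "0 \<le> (\<Sum>i\<in>T. K i i - 2 * s * Y i i + s\<^sup>2 * quad_on T H (\<lambda>l. Y l i))"
    by (intro sum_nonneg inverse_diag_quad_ineq T H K)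
  then show "0 \<le> (\<Sum>i\<in>T. K i i) - 2 * s * (\<Sum>i\<in>T. Y i i) + s\<^sup>2 * (\<Sum>i\<in>T. quad_on T H (\<lambda>l. Y l i))"
    by (simp add: sum.distrib sum_subtractf sum_distrib_left)
qed (intro sum_nonneg pos_def_on_nonneg H)

abbreviation shift :: "('i \<Rightarrow> 'i \<Rightarrow> real) \<Rightarrow> real \<Rightarrow> 'i \<Rightarrow> 'i \<Rightarrow> real" where
  "shift H \<delta> \<equiv> \<lambda>i j. H i j - \<delta> * of_bool (i = j)"

lemma quad_on_shift:
  assumes "finite T"
  shows "quad_on T (shift H \<delta>) v = quad_on T H v - \<delta> * (\<Sum>i\<in>T. (v i)\<^sup>2)"
proof -
  have "quad_on T (shift H \<delta>) v
      = (\<Sum>i\<in>T. v i * ((\<Sum>j\<in>T. H i j * v j) - \<delta> * (\<Sum>j\<in>T. of_bool (i = j) * v j)))"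
    by (simp add: quad_on_alt algebra_simps sum_subtractf sum_distrib_left)
  also have "\<dots> = (\<Sum>i\<in>T. v i * ((\<Sum>j\<in>T. H i j * v j) - \<delta> * v i))"
    using assms by (intro sum.cong refl) (simp only: sum_of_bool_mult)
  finally show ?thesis
    by (simp add: quad_on_alt algebra_simps sum_subtractf sum_distrib_left power2_eq_square)
qed

text \<open>The largest eigenvalue of \<open>K\<close> is at most its trace, hence at most \<phi>,
  so the smallest eigenvalue of \<open>H\<close> is at least \<open>1 / \<phi>\<close> and exceeds
  \<delta>.\<close>

lemma pos_def_on_shift:
  assumes T: "finite T" and H: "pos_def_on T H" and K: "sym_inverse_on T H K"
    and \<phi>: "(\<Sum>i\<in>T. K i i) \<le> \<phi>" and \<delta>: "0 \<le> \<delta>" "\<delta> * \<phi> < 1"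
  shows "pos_def_on T (shift H \<delta>)"
  unfolding pos_def_on_def
proof (intro conjI allI impI ballI)
  fix i j assume "i \<in> T" "j \<in> T"
  then show "shift H \<delta> i j = shift H \<delta> j i" using H by (auto simp: pos_def_on_def)
next
  fix v :: "'a \<Rightarrow> real" assume v: "\<exists>i\<in>T. v i \<noteq> 0"
  define a where "a = (\<Sum>i\<in>T. (v i)\<^sup>2)"
  define q where "q = quad_on T H v"
  have q: "0 < q" using H v by (simp add: pos_def_on_def q_def)
  have a: "0 < a" unfolding a_def using v T by (auto intro: sum_pos2)
  \<comment> \<open>Cauchy--Schwarz is applied to the rank-one matrix \<open>v v\<^sup>T\<close>,
    whose trace is \<open>a\<close>; this replaces the eigenvalue estimate.\<close>
  have "(\<Sum>i\<in>T. quad_on T H (\<lambda>l. v l * v i)) = a * q"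
    unfolding a_def sum_distrib_right
    by (intro sum.cong refl)
      (simp add: q_def quad_on_def sum_distrib_left power2_eq_square mult_ac)
  then have "a\<^sup>2 \<le> (\<Sum>i\<in>T. K i i) * (a * q)"
    using trace_Cauchy_Schwarz[OF T H K, of "\<lambda>l i. v l * v i"] by (simp add: a_def power2_eq_square)
  also have "\<dots> \<le> \<phi> * (a * q)" using \<phi> a q by (intro mult_right_mono) auto
  finally have "a \<le> \<phi> * q" using a by (simp add: power2_eq_square)
  then have "\<delta> * a \<le> \<delta> * (\<phi> * q)" using \<delta> by (intro mult_left_mono)
  also have "\<dots> < q" using mult_strict_right_mono[OF \<delta>(2) q] by (simp add: mult.assoc)
  finally show "0 < quad_on T (shift H \<delta>) v"
    unfolding quad_on_shift[OF T] by (simp add: a_def q_def)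
qed

lemma pos_def_on_subset:
  assumes T: "finite T" and H: "pos_def_on T H" and U: "U \<subseteq> T"
  shows "pos_def_on U H"
  unfolding pos_def_on_def
proof (intro conjI allI impI ballI)
  fix v :: "'a \<Rightarrow> real" assume v: "\<exists>i\<in>U. v i \<noteq> 0"
  define v' where "v' i = (if i \<in> U then v i else 0)" for i
  have "quad_on T H v' = quad_on U H v"
  proof -
    have "quad_on T H v' = (\<Sum>i\<in>U. \<Sum>j\<in>T. v' i * H i j * v' j)"
      unfolding quad_on_def using T U
      by (intro sum.mono_neutral_right) (auto simp: v'_def)
    also have "\<dots> = (\<Sum>i\<in>U. \<Sum>j\<in>U. v' i * H i j * v' j)"
      using T U by (intro sum.cong refl sum.mono_neutral_right) (auto simp: v'_def)
    finally show ?thesis by (simp add: quad_on_def v'_def)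
  qed
  moreover have "\<exists>i\<in>T. v' i \<noteq> 0" using v U by (auto simp: v'_def)
  ultimately show "0 < quad_on U H v" using H unfolding pos_def_on_def by metis
next
  fix i j assume "i \<in> U" "j \<in> U"
  with H U show "H i j = H j i" unfolding pos_def_on_def by blast
qed

text \<open>Induction by bordering. With \<open>g = K h\<close> for the new column \<open>h\<close>,
  the Schur complement \<open>s\<close> is the value of the form at a nonzero vector, hence
  positive, and the block inverse formula can divide by it.\<close>

lemma pos_def_on_has_inverse:
  assumes "finite T" and "pos_def_on T H"
  shows "\<exists>K. sym_inverse_on T H K"
  using assms
proof (induction T rule: finite_induct)
  case empty
  then show ?case by (simp add: sym_inverse_on_def)
next
  case (insert a T)
  have "pos_def_on T H" using insert by (auto intro: pos_def_on_subset[of "insert a T"])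
  with insert obtain K where K: "sym_inverse_on T H K" by auto
  have sym: "H i j = H j i" if "i \<in> insert a T" "j \<in> insert a T" for i j
    using insert.prems that by (auto simp: pos_def_on_def)
  have Ksym: "K i j = K j i" if "i \<in> T" "j \<in> T" for i j
    using K that by (auto simp: sym_inverse_on_def)
  have HK: "(\<Sum>l\<in>T. H i l * K l j) = of_bool (i = j)" if "i \<in> T" "j \<in> T" for i j
    using K that by (auto simp: sym_inverse_on_def)
  define g where "g i = (\<Sum>j\<in>T. K i j * H j a)" for i
  define s where "s = H a a - (\<Sum>i\<in>T. H a i * g i)"
  have Hg: "(\<Sum>l\<in>T. H i l * g l) = H i a" if i: "i \<in> T" for i
  proof -
    have "(\<Sum>l\<in>T. H i l * g l) = (\<Sum>j\<in>T. (\<Sum>l\<in>T. H i l * K l j) * H j a)"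
      unfolding g_def sum_distrib_left sum_distrib_right by (subst sum.swap) (simp add: mult.assoc)
    also have "\<dots> = (\<Sum>j\<in>T. of_bool (i = j) * H j a)"
      using i by (intro sum.cong refl) (simp add: HK)
    finally show ?thesis using insert.hyps(1) i by (simp only: sum_of_bool_mult)
  qed
  have hK: "(\<Sum>l\<in>T. H a l * K l j) = g j" if "j \<in> T" for j
    unfolding g_def using that sym Ksym by (intro sum.cong refl) auto
  \<comment> \<open>The minimizer of the form among vectors with entry 1 at \<open>a\<close>; its
    value there is \<open>s\<close>.\<close>
  define v where "v i = (if i = a then 1 else - g i)" for i
  have vT: "(\<Sum>i\<in>T. f i (v i)) = (\<Sum>i\<in>T. f i (- g i))" for f :: "'a \<Rightarrow> real \<Rightarrow> real"
    using insert.hyps(2) by (intro sum.cong refl) (auto simp: v_def)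
  have "quad_on (insert a T) H v = s"
    unfolding quad_on_alt using insert.hyps
    by (simp add: vT[of "\<lambda>i x. H _ i * x"] vT[of "\<lambda>i x. x * _ i"])
       (simp add: v_def s_def sum_negf Hg cong: sum.cong)
  moreover have "\<exists>i\<in>insert a T. v i \<noteq> 0" by (auto simp: v_def)
  ultimately have s: "0 < s" using insert.prems unfolding pos_def_on_def by metis
  define K' where "K' i j = (if i = a then if j = a then 1 / s else - g j / s
    else if j = a then - g i / s else K i j + g i * g j / s)" for i j
  have K'T: "K' i j = K i j + g i * g j / s" "K' i a = - g i / s" "K' a i = - g i / s"
    if "i \<in> T" "j \<in> T" for i j
    using that insert.hyps(2) by (auto simp: K'_def)
  have K'a: "K' a a = 1 / s" by (simp add: K'_def)
  have sT: "(\<Sum>l\<in>T. H i l * K' l j) = (\<Sum>l\<in>T. H i l * K l j) + (\<Sum>l\<in>T. H i l * g l) * g j / s"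
    if "j \<in> T" for i j
  proof -
    have "(\<Sum>l\<in>T. H i l * K' l j) = (\<Sum>l\<in>T. H i l * K l j + H i l * g l * g j / s)"
      using that by (intro sum.cong refl) (simp add: K'T algebra_simps)
    then show ?thesis by (simp add: sum.distrib sum_distrib_right sum_divide_distrib)
  qed
  have sa: "(\<Sum>l\<in>T. H i l * K' l a) = - (\<Sum>l\<in>T. H i l * g l) / s" for i
  proof -
    have "(\<Sum>l\<in>T. H i l * K' l a) = (\<Sum>l\<in>T. - (H i l * g l) / s)"
      by (intro sum.cong refl) (simp add: K'T)
    then show ?thesis by (simp add: sum_negf sum_divide_distrib)
  qed
  have "sym_inverse_on (insert a T) H K'"
    unfolding sym_inverse_on_def
  proof (intro conjI ballI)
    fix i j assume "i \<in> insert a T" "j \<in> insert a T"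
    then show "K' i j = K' j i" by (auto simp: K'_def Ksym)
  next
    fix i j assume ij: "i \<in> insert a T" "j \<in> insert a T"
    have as: "(\<Sum>i\<in>T. H a i * g i) = H a a - s" by (simp add: s_def)
    have "(\<Sum>l\<in>insert a T. H i l * K' l j) = H i a * K' a j + (\<Sum>l\<in>T. H i l * K' l j)"
      using insert.hyps by simp
    also have "\<dots> = of_bool (i = j)"
    proof (cases "i = a"; cases "j = a")
      assume "i = a" "j = a"
      then show ?thesis using s by (simp add: sa as K'a diff_divide_distrib)
    next
      assume "i = a" "j \<noteq> a"
      moreover from this have "j \<in> T" using ij by simp
      ultimately show ?thesis using s K'T(3)[of j j] hK[of j]
        by (simp only: sT as) (simp add: left_diff_distrib diff_divide_distrib)
    next
      assume "i \<noteq> a" "j = a"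
      then show ?thesis using ij s by (simp add: sa Hg K'a)
    next
      assume "i \<noteq> a" "j \<noteq> a"
      moreover from this have "j \<in> T" "i \<in> T" using ij by auto
      ultimately show ?thesis using s K'T(3)[of j j] HK[of i j] Hg[of i] by (simp only: sT) simp
    qed
    finally show "(\<Sum>l\<in>insert a T. H i l * K' l j) = of_bool (i = j)" .
  qed
  then show ?case by blast
qed


text \<open>Deleting index \<open>j\<close> from a positive definite matrix with inverse \<open>R\<close> changes the trace of the
  inverse to \<open>tr R - (R\<^sup>2)\<^sub>j\<^sub>j / R\<^sub>j\<^sub>j\<close>; the average of this over \<open>j\<close> with weights \<open>R\<^sub>j\<^sub>j\<close> is
  \<open>((tr R)\<^sup>2 - tr (R\<^sup>2)) / tr R\<close>.\<close>

lemma barrier_step: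
  assumes T: "finite T" "T \<noteq> {}" and H: "pos_def_on T H" and K: "sym_inverse_on T H K"
    and \<phi>: "(\<Sum>i\<in>T. K i i) \<le> \<phi>" and \<delta>: "0 \<le> \<delta>" "\<delta> * \<phi> < 1"
  obtains j K' where "j \<in> T" "pos_def_on (T - {j}) (shift H \<delta>)"
    "sym_inverse_on (T - {j}) (shift H \<delta>) K'" "(\<Sum>i\<in>T - {j}. K' i i) \<le> \<phi>"
proof -
  have H': "pos_def_on T (shift H \<delta>)" by (rule pos_def_on_shift[OF T(1) H K \<phi> \<delta>])
  obtain R where R: "sym_inverse_on T (shift H \<delta>) R" using pos_def_on_has_inverse[OF T(1) H'] ..
  have Rsym: "R i j = R j i" if "i \<in> T" "j \<in> T" for i j
    using R that by (auto simp: sym_inverse_on_def)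
  have HR: "(\<Sum>l\<in>T. shift H \<delta> i l * R l j) = of_bool (i = j)" if "i \<in> T" "j \<in> T" for i j
    using R that unfolding sym_inverse_on_def by blast
  have quadR: "quad_on T (shift H \<delta>) (\<lambda>l. R l j) = R j j" if j: "j \<in> T" for j
  proof -
    have "quad_on T (shift H \<delta>) (\<lambda>l. R l j) = (\<Sum>i\<in>T. R i j * of_bool (i = j))"
      unfolding quad_on_alt using j by (intro sum.cong refl) (simp only: HR)
    then show ?thesis using T(1) j by (simp only: sum_of_bool_mult)
  qed
  have Rpos: "0 < R j j" if j: "j \<in> T" for j
  proof -
    have "\<exists>l\<in>T. R l j \<noteq> 0"
    proof (rule ccontr)
      assume "\<not> ?thesis"
      then have "(\<Sum>l\<in>T. shift H \<delta> j l * R l j) = 0" by (intro sum.neutral) auto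
      with HR[OF j j] show False by simp
    qed
    then have "0 < quad_on T (shift H \<delta>) (\<lambda>l. R l j)"
      using H'[unfolded pos_def_on_def, THEN conjunct2, rule_format, of "\<lambda>l. R l j"] by blast
    with quadR[OF j] show ?thesis by simp
  qed
  define p where "p = (\<Sum>i\<in>T. R i i)"
  define q where "q j = (\<Sum>l\<in>T. (R l j)\<^sup>2)" for j
  have q0: "0 \<le> sum q T" by (intro sum_nonneg) (simp add: q_def sum_nonneg)
  have p0: "0 \<le> p" unfolding p_def using Rpos by (intro sum_nonneg) (simp add: less_imp_le)
  \<comment> \<open>\<open>H\<close> is the shifted form plus \<delta> times the identity. Summed
    over the columns of \<open>R\<close> it gives \<open>tr R + \<delta> tr (R\<^sup>2)\<close>, so
    Cauchy--Schwarz with \<open>Y = R\<close> relates the trace after the shift to that of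
    \<open>K\<close>.\<close>
  have "quad_on T H (\<lambda>l. R l j) = R j j + \<delta> * q j" if "j \<in> T" for j
    using quadR[OF that] quad_on_shift[OF T(1), of H \<delta> "\<lambda>l. R l j"] by (simp add: q_def)
  then have "(\<Sum>j\<in>T. quad_on T H (\<lambda>l. R l j)) = p + \<delta> * sum q T"
    by (simp add: sum.distrib sum_distrib_left p_def)
  with trace_Cauchy_Schwarz[OF T(1) H K, of R]
  have "p\<^sup>2 \<le> (\<Sum>i\<in>T. K i i) * (p + \<delta> * sum q T)" by (simp add: p_def)
  also have "\<dots> \<le> \<phi> * (p + \<delta> * sum q T)"
    using \<phi> p0 q0 \<delta>(1) by (intro mult_right_mono) auto
  also have "\<dots> = \<phi> * p + (\<delta> * \<phi>) * sum q T" by (simp add: algebra_simps)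
  also have "\<dots> \<le> \<phi> * p + 1 * sum q T"
    using q0 \<delta>(2) by (intro add_left_mono mult_right_mono) auto
  finally have pq: "p * p - sum q T \<le> \<phi> * p" by (simp add: power2_eq_square)
  \<comment> \<open>If every index failed, summing the failures would contradict \<open>pq\<close>.
    The weights \<open>R j j\<close> are already built in, because the inequality is multiplied by
    them.\<close>
  have "\<exists>j\<in>T. p * R j j - q j \<le> \<phi> * R j j"
  proof (rule ccontr)
    assume "\<not> ?thesis"
    then have "(\<Sum>j\<in>T. \<phi> * R j j) < (\<Sum>j\<in>T. p * R j j - q j)"
      using T by (intro sum_strict_mono) auto
    also have "\<dots> = p * p - sum q T" by (simp add: sum_subtractf p_def sum_distrib_left)
    finally show False using pq by (simp add: p_def sum_distrib_left)
  qed
  then obtain j where j: "j \<in> T" and jle: "p * R j j - q j \<le> \<phi> * R j j" by blast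
  \<comment> \<open>The inverse of a principal submatrix is a Schur complement in the full inverse.
    Row \<open>j\<close> of \<open>K'\<close> vanishes, so sums over \<open>T - {j}\<close> may be
    extended to \<open>T\<close>.\<close>
  define K' where "K' i l = R i l - R i j * R j l / R j j" for i l
  have K'j: "K' j i = 0" for i using Rpos[OF j] by (simp add: K'_def)
  show thesis
  proof
    show "j \<in> T" by fact
    show "pos_def_on (T - {j}) (shift H \<delta>)" using T(1) H' by (rule pos_def_on_subset) auto
    show "sym_inverse_on (T - {j}) (shift H \<delta>) K'"
      unfolding sym_inverse_on_def
    proof (intro conjI ballI)
      fix i l assume il: "i \<in> T - {j}" "l \<in> T - {j}"
      then show "K' i l = K' l i" using j Rsym by (simp add: K'_def)
    next
      fix i l assume il: "i \<in> T - {j}" "l \<in> T - {j}"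
      have "(\<Sum>t\<in>T - {j}. shift H \<delta> i t * K' t l) = (\<Sum>t\<in>T. shift H \<delta> i t * K' t l)"
        using T(1) by (intro sum.mono_neutral_left) (auto simp: K'j)
      also have "\<dots> = (\<Sum>t\<in>T. shift H \<delta> i t * R t l)
          - (\<Sum>t\<in>T. shift H \<delta> i t * R t j) * R j l / R j j"
        by (simp only: K'_def right_diff_distrib sum_subtractf sum_distrib_right
            sum_divide_distrib mult.assoc times_divide_eq_right)
      also have "\<dots> = of_bool (i = l)"
        using il j by (subst (1 2) HR) auto
      finally show "(\<Sum>t\<in>T - {j}. shift H \<delta> i t * K' t l) = of_bool (i = l)" .
    qed
    have "(\<Sum>i\<in>T - {j}. K' i i) = (\<Sum>i\<in>T. K' i i)"
      using T(1) by (intro sum.mono_neutral_left) (auto simp: K'j)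
    also have "\<dots> = (\<Sum>i\<in>T. R i i - (R i j)\<^sup>2 / R j j)"
      using j Rsym by (intro sum.cong refl) (simp add: K'_def power2_eq_square)
    also have "\<dots> = p - q j / R j j" by (simp add: p_def q_def sum_subtractf sum_divide_distrib)
    also have "\<dots> \<le> \<phi>" using jle Rpos[OF j] by (simp add: field_simps)
    finally show "(\<Sum>i\<in>T - {j}. K' i i) \<le> \<phi>" .
  qed
qed

text \<open>Each step restores the same bound \<phi> on the trace, so the same \<delta> can be used
  every time.\<close>

lemma barrier_iterate:
  assumes T: "finite T" and H: "pos_def_on T H" and K: "sym_inverse_on T H K"
    and \<phi>: "(\<Sum>i\<in>T. K i i) \<le> \<phi>" and \<delta>: "0 \<le> \<delta>" "\<delta> * \<phi> < 1" and k: "k \<le> card T"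
  shows "\<exists>U K'. U \<subseteq> T \<and> card U = card T - k \<and> pos_def_on U (shift H (real k * \<delta>)) \<and>
    sym_inverse_on U (shift H (real k * \<delta>)) K' \<and> (\<Sum>i\<in>U. K' i i) \<le> \<phi>"
  using k
proof (induction k)
  case 0
  then show ?case using H K \<phi> by auto
next
  case (Suc k)
  then obtain U K' where U: "U \<subseteq> T" "card U = card T - k"
    "pos_def_on U (shift H (real k * \<delta>))" "sym_inverse_on U (shift H (real k * \<delta>)) K'"
    "(\<Sum>i\<in>U. K' i i) \<le> \<phi>" by auto
  have fU: "finite U" "U \<noteq> {}" using U(1,2) T Suc.prems by (auto intro: finite_subset)
  obtain j K'' where j: "j \<in> U" "pos_def_on (U - {j}) (shift (shift H (real k * \<delta>)) \<delta>)"
    "sym_inverse_on (U - {j}) (shift (shift H (real k * \<delta>)) \<delta>) K''" "(\<Sum>i\<in>U - {j}. K'' i i) \<le> \<phi>"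
    by (rule barrier_step[OF fU U(3,4,5) \<delta>])
  have eq: "shift (shift H (real k * \<delta>)) \<delta> = shift H (real (Suc k) * \<delta>)"
    by (intro ext) (simp add: algebra_simps)
  have "card (U - {j}) = card T - Suc k" using j(1) fU U(2) by simp
  then show ?case using j U(1) unfolding eq by (intro exI[of _ "U - {j}"] exI[of _ K'']) auto
qed

lemma restricted_pos_def_subset:
  assumes T: "finite T" and H: "pos_def_on T H" and K: "sym_inverse_on T H K"
    and \<phi>: "(\<Sum>i\<in>T. K i i) \<le> \<phi>" and \<delta>: "0 \<le> \<delta>" "\<delta> * \<phi> < 1" and k: "k \<le> card T"
  obtains U where "U \<subseteq> T" "card U = card T - k" "pos_def_on U (shift H ((real k + 1) * \<delta>))"
proof -
  obtain U K' where U: "U \<subseteq> T" "card U = card T - k"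
    "pos_def_on U (shift H (real k * \<delta>))" "sym_inverse_on U (shift H (real k * \<delta>)) K'"
    "(\<Sum>i\<in>U. K' i i) \<le> \<phi>" using barrier_iterate[OF assms] by blast
  have "finite U" using U(1) T by (rule finite_subset)
  \<comment> \<open>A deletion is the price for restoring the trace bound, not for positivity. The
    last shift needs positivity alone, which turns \<open>k\<close> into
    \<open>k + 1\<close>.\<close>
  from pos_def_on_shift[OF this U(3,4,5) \<delta>]
  have "pos_def_on U (shift (shift H (real k * \<delta>)) \<delta>)" .
  also have "shift (shift H (real k * \<delta>)) \<delta> = shift H ((real k + 1) * \<delta>)"
    by (intro ext) (simp add: algebra_simps)
  finally show thesis using that U(1,2) by blast
qed

subsection \<open>Pseudoinverses and full row rank\<close>

text \<open>The library states these laws with carrier premises; in terms of dimensions the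
  simplifier can discharge the side conditions.\<close>

lemma mat_mult_assoc_dim:
  fixes A B C :: "real mat"
  shows "dim_col A = dim_row B \<Longrightarrow> dim_col B = dim_row C \<Longrightarrow> (A * B) * C = A * (B * C)"
  by (rule assoc_mult_mat[of _ "dim_row A" "dim_col A" _ "dim_col B" _ "dim_col C"]) auto

lemma mat_transpose_mult_dim:
  fixes A B :: "real mat"
  shows "dim_col A = dim_row B \<Longrightarrow> transpose_mat (A * B) = transpose_mat B * transpose_mat A"
  by (rule transpose_mult[of _ "dim_row A" "dim_col A" _ "dim_col B"]) auto

lemma mat_transpose_add_dim:
  fixes A B :: "real mat"
  shows "dim_row A = dim_row B \<Longrightarrow> dim_col A = dim_col B \<Longrightarrow>
    transpose_mat (A + B) = transpose_mat A + transpose_mat B"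
  by (rule transpose_add[of _ "dim_row A" "dim_col A"]) auto

lemma mat_transpose_minus_dim:
  fixes A B :: "real mat"
  shows "dim_row A = dim_row B \<Longrightarrow> dim_col A = dim_col B \<Longrightarrow>
    transpose_mat (A - B) = transpose_mat A - transpose_mat B"
  by (rule transpose_minus[of _ "dim_row A" "dim_col A"]) auto

lemma mat_transpose_smult: "transpose_mat (a \<cdot>\<^sub>m A) = a \<cdot>\<^sub>m transpose_mat (A :: real mat)"
  by (intro eq_matI) auto

lemma mat_add_mult_dim:
  fixes A B C :: "real mat"
  shows "dim_row A = dim_row B \<Longrightarrow> dim_col A = dim_col B \<Longrightarrow> dim_col B = dim_row C \<Longrightarrow>
    (A + B) * C = A * C + B * C"
  by (rule add_mult_distrib_mat[of _ "dim_row A" "dim_col A" _ _ "dim_col C"]) auto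

lemma mat_mult_add_dim:
  fixes A B C :: "real mat"
  shows "dim_row B = dim_row C \<Longrightarrow> dim_col B = dim_col C \<Longrightarrow> dim_col A = dim_row C \<Longrightarrow>
    A * (B + C) = A * B + A * C"
  by (rule mult_add_distrib_mat[of _ "dim_row A" "dim_col A" _ "dim_col C"]) auto

lemma mat_minus_mult_dim:
  fixes A B C :: "real mat"
  shows "dim_row A = dim_row B \<Longrightarrow> dim_col A = dim_col B \<Longrightarrow> dim_col B = dim_row C \<Longrightarrow>
    (A - B) * C = A * C - B * C"
  by (rule minus_mult_distrib_mat[of _ "dim_row A" "dim_col A" _ _ "dim_col C"]) auto

lemma mat_mult_minus_dim:
  fixes A B C :: "real mat"
  shows "dim_row B = dim_row C \<Longrightarrow> dim_col B = dim_col C \<Longrightarrow> dim_col A = dim_row C \<Longrightarrow>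
    A * (B - C) = A * B - A * C"
  by (rule mult_minus_distrib_mat[of _ "dim_row A" "dim_col A" _ "dim_col C"]) auto

lemma mat_smult_mult_dim:
  fixes A B :: "real mat"
  shows "dim_col A = dim_row B \<Longrightarrow> (a \<cdot>\<^sub>m A) * B = a \<cdot>\<^sub>m (A * B)"
  by (rule mult_smult_assoc_mat[of _ "dim_row A" "dim_col A" _ "dim_col B"]) auto

lemma mat_mult_smult_dim:
  fixes A B :: "real mat"
  shows "dim_col A = dim_row B \<Longrightarrow> A * (a \<cdot>\<^sub>m B) = a \<cdot>\<^sub>m (A * B)"
  by (rule mult_smult_distrib[of _ "dim_row A" "dim_col A" _ "dim_col B"]) auto

lemma mat_mult_vec_assoc_dim:
  fixes A B :: "real mat"
  shows "dim_col A = dim_row B \<Longrightarrow> dim_col B = dim_vec v \<Longrightarrow> (A * B) *\<^sub>v v = A *\<^sub>v (B *\<^sub>v v)"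
  by (rule assoc_mult_mat_vec[of _ "dim_row A" "dim_col A" _ "dim_col B"]) auto

lemma scalar_prod_mult_mat_vec_dim:
  fixes A :: "real mat"
  shows "dim_vec x = dim_row A \<Longrightarrow> dim_vec y = dim_col A \<Longrightarrow>
    x \<bullet> (A *\<^sub>v y) = (transpose_mat A *\<^sub>v x) \<bullet> y"
  by (rule transpose_vec_mult_scalar[symmetric, of _ "dim_row A" "dim_col A"]) (auto intro: carrier_vecI)

lemmas mat_dim_algebra =
  mat_mult_assoc_dim mat_transpose_mult_dim mat_transpose_add_dim mat_transpose_minus_dim
  mat_transpose_smult mat_add_mult_dim mat_mult_add_dim mat_minus_mult_dim mat_mult_minus_dim
  mat_smult_mult_dim mat_mult_smult_dim

section \<open>Traces, Frobenius norms and scalar products\<close>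

definition mat_trace :: "real mat \<Rightarrow> real" where
  "mat_trace X = (\<Sum>i<dim_row X. X $$ (i, i))"

lemma mat_trace_mult:
  assumes "dim_col X = dim_row Y" "dim_row X = dim_col Y"
  shows "mat_trace (X * Y) = (\<Sum>i<dim_row X. \<Sum>j<dim_col X. X $$ (i, j) * Y $$ (j, i))"
  using assms by (simp add: mat_trace_def scalar_prod_def atLeast0LessThan)

lemma mat_trace_comm:
  assumes "dim_col X = dim_row Y" "dim_row X = dim_col Y"
  shows "mat_trace (X * Y) = mat_trace (Y * X)"
  using assms by (simp add: mat_trace_mult) (subst sum.swap, simp add: mult.commute)

lemma mat_trace_linear:
  "dim_row X = dim_row Y \<Longrightarrow> dim_col Y = dim_row Y \<Longrightarrow> mat_trace (X + Y) = mat_trace X + mat_trace Y"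
  "dim_row X = dim_row Y \<Longrightarrow> dim_col Y = dim_row Y \<Longrightarrow> mat_trace (X - Y) = mat_trace X - mat_trace Y"
  "dim_col X = dim_row X \<Longrightarrow> mat_trace (a \<cdot>\<^sub>m X) = a * mat_trace X"
  "mat_trace (1\<^sub>m p) = real p"
  by (simp_all add: mat_trace_def sum.distrib sum_subtractf sum_distrib_left)

lemma frobenius_norm_square:
  "(frobenius_norm X)\<^sup>2 = (\<Sum>i<dim_row X. \<Sum>j<dim_col X. (X $$ (i, j))\<^sup>2)"
  unfolding frobenius_norm_def by (rule real_sqrt_pow2) (intro sum_nonneg zero_le_power2)

lemma frobenius_norm_square_trace: "(frobenius_norm X)\<^sup>2 = mat_trace (X * transpose_mat X)"
  by (simp add: frobenius_norm_square mat_trace_mult flip: power2_eq_square)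

lemma frobenius_norm_square_trace': "(frobenius_norm X)\<^sup>2 = mat_trace (transpose_mat X * X)"
  by (simp add: frobenius_norm_square_trace mat_trace_comm)

lemma mat_trace_transpose: "dim_row X = dim_col X \<Longrightarrow> mat_trace (transpose_mat X) = mat_trace X"
  by (simp add: mat_trace_def)

text \<open>For such \<open>P\<close> the trace is the squared Frobenius norm.\<close>

lemma trace_orthogonal_projection_nonneg:
  assumes "transpose_mat P = P" "P * P = P"
  shows "0 \<le> mat_trace P"
  using frobenius_norm_square_trace[of P] assms by (metis zero_le_power2)

lemma euclidean_norm_vec_square: "(euclidean_norm_vec v)\<^sup>2 = v \<bullet> v"
proof -
  have "(euclidean_norm_vec v)\<^sup>2 = (\<Sum>i<dim_vec v. (v $ i)\<^sup>2)"
    unfolding euclidean_norm_vec_def by (rule real_sqrt_pow2) (intro sum_nonneg zero_le_power2)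
  then show ?thesis by (simp add: scalar_prod_def atLeast0LessThan power2_eq_square)
qed

lemma real_scalar_prod_self: "0 \<le> v \<bullet> v" "v \<bullet> v = 0 \<Longrightarrow> v = 0\<^sub>v (dim_vec v)" for v :: "real vec"
proof -
  show "0 \<le> v \<bullet> v" by (metis euclidean_norm_vec_square zero_le_power2)
  assume "v \<bullet> v = 0"
  then have "(\<Sum>i<dim_vec v. v $ i * v $ i) = 0" by (simp add: scalar_prod_def atLeast0LessThan)
  then have "\<forall>i\<in>{..<dim_vec v}. v $ i * v $ i = 0"
    by (subst (asm) sum_nonneg_eq_0_iff) auto
  then show "v = 0\<^sub>v (dim_vec v)" by (intro eq_vecI) auto
qed

section \<open>Rank factorization and the Moore--Penrose inverse\<close>

lemma injective_square_mat_inverse: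
  fixes M :: "real mat"
  assumes M: "M \<in> carrier_mat n n" and sym: "transpose_mat M = M"
    and inj: "\<And>v. v \<in> carrier_vec n \<Longrightarrow> M *\<^sub>v v = 0\<^sub>v n \<Longrightarrow> v = 0\<^sub>v n"
  obtains W where "W \<in> carrier_mat n n" "M * W = 1\<^sub>m n" "W * M = 1\<^sub>m n" "transpose_mat W = W"
proof -
  have "det M \<noteq> 0" using det_0_iff_vec_prod_zero_field[OF M] inj by blast
  from det_non_zero_imp_unit[OF M this, unfolded Units_def, of "()"]
  obtain W where W: "W \<in> carrier_mat n n" and WM: "W * M = 1\<^sub>m n" and MW: "M * W = 1\<^sub>m n"
    by (auto simp: ring_mat_def)
  have "transpose_mat W * M = transpose_mat (M * W)" using M W sym by (simp add: mat_dim_algebra)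
  also have "\<dots> = 1\<^sub>m n" by (simp add: MW)
  finally have "transpose_mat W * M * W = W" using W by simp
  then have "transpose_mat W = W" using M W MW by (simp add: mat_mult_assoc_dim)
  with that W WM MW show thesis by blast
qed

lemma gram_mat_inverse:
  fixes X :: "real mat"
  assumes X: "X \<in> carrier_mat p q"
    and inj: "\<And>v. v \<in> carrier_vec q \<Longrightarrow> X *\<^sub>v v = 0\<^sub>v p \<Longrightarrow> v = 0\<^sub>v q"
  obtains W where "W \<in> carrier_mat q q" "(transpose_mat X * X) * W = 1\<^sub>m q"
    "W * (transpose_mat X * X) = 1\<^sub>m q" "transpose_mat W = W"
proof -
  have inj': "v = 0\<^sub>v q" if v: "v \<in> carrier_vec q" and 0: "(transpose_mat X * X) *\<^sub>v v = 0\<^sub>v q" for v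
  proof -
    have "(X *\<^sub>v v) \<bullet> (X *\<^sub>v v) = v \<bullet> ((transpose_mat X * X) *\<^sub>v v)"
      using X v by (simp add: mat_mult_vec_assoc_dim scalar_prod_mult_mat_vec_dim)
    also have "\<dots> = 0" using v by (simp add: 0)
    finally have "X *\<^sub>v v = 0\<^sub>v p" using real_scalar_prod_self(2) X by fastforce
    with inj v show ?thesis by blast
  qed
  have "transpose_mat X * X \<in> carrier_mat q q"
    "transpose_mat (transpose_mat X * X) = transpose_mat X * X"
    using X by (simp_all add: mat_transpose_mult_dim)
  from injective_square_mat_inverse[OF this inj'] that show thesis by metis
qed

lemma mat_eq_by_vecs:
  fixes X Y :: "real mat"
  assumes "X \<in> carrier_mat p q" "Y \<in> carrier_mat p q"
    and eq: "\<And>v. v \<in> carrier_vec q \<Longrightarrow> X *\<^sub>v v = Y *\<^sub>v v"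
  shows "X = Y"
proof (rule eq_matI)
  fix i j assume ij: "i < dim_row Y" "j < dim_col Y"
  have "(X *\<^sub>v unit_vec q j) $ i = (Y *\<^sub>v unit_vec q j) $ i" by (simp add: eq)
  then show "X $$ (i, j) = Y $$ (i, j)" using assms(1,2) ij by simp
qed (use assms in auto)

lemma factor_through_columns:
  fixes E X :: "real mat"
  assumes X: "X \<in> carrier_mat n q" and E: "E \<in> carrier_mat n p"
    and cols: "\<And>j. j < q \<Longrightarrow> \<exists>x\<in>carrier_vec p. E *\<^sub>v x = col X j"
  obtains F where "F \<in> carrier_mat p q" "X = E * F"
proof -
  obtain f where f: "\<And>j. j < q \<Longrightarrow> f j \<in> carrier_vec p \<and> E *\<^sub>v f j = col X j"
    using cols by metis
  define F where "F = mat_of_cols p (map f [0..<q])"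
  have F: "F \<in> carrier_mat p q" by (simp add: F_def carrier_matI)
  have "X = E * F"
  proof (rule eq_matI)
    fix i j assume "i < dim_row (E * F)" "j < dim_col (E * F)"
    then have ij: "i < n" "j < q" using E F by auto
    then have "col F j = f j" using f by (simp add: F_def)
    then have "(E * F) $$ (i, j) = (E *\<^sub>v f j) $ i" using ij E F by simp
    then show "X $$ (i, j) = (E * F) $$ (i, j)" using f ij X by simp
  qed (use E F X in auto)
  with F that show thesis by blast
qed

text \<open>The columns of \<open>E\<close> are a maximal independent set of columns of
  \<open>Q\<close>, and \<open>F\<close> holds the coordinates of all columns of \<open>Q\<close> in
  that basis.\<close>

lemma full_rank_factorization:
  fixes Q :: "real mat"
  assumes Q: "Q \<in> carrier_mat n l"
  obtains E F where "E \<in> carrier_mat n (vec_space.rank n Q)" "F \<in> carrier_mat (vec_space.rank n Q) l"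
    "Q = E * F"
    "\<And>v. v \<in> carrier_vec (vec_space.rank n Q) \<Longrightarrow> E *\<^sub>v v = 0\<^sub>v n \<Longrightarrow> v = 0\<^sub>v (vec_space.rank n Q)"
    "\<And>v. v \<in> carrier_vec (vec_space.rank n Q) \<Longrightarrow> transpose_mat F *\<^sub>v v = 0\<^sub>v l \<Longrightarrow>
       v = 0\<^sub>v (vec_space.rank n Q)"
proof -
  interpret vec_space "TYPE(real)" n .
  define r where "r = rank Q"
  have colsQ: "set (cols Q) \<subseteq> carrier_vec n" using Q cols_dim by blast
  have "lin_indpt {}" unfolding lin_dep_def by auto
  then obtain S where S: "finite S" "maximal S (\<lambda>T. T \<subseteq> set (cols Q) \<and> lin_indpt T)"
    using maximal_exists_superset[of "set (cols Q)" "\<lambda>T. T \<subseteq> set (cols Q) \<and> lin_indpt T" "{}"]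
    by auto
  have rS: "r = card S" unfolding r_def by (rule rank_card_indpt[OF Q S(2)])
  have SQ: "S \<subseteq> set (cols Q)" and Sind: "lin_indpt S" using S(2) by (auto simp: maximal_def)
  have Sn: "S \<subseteq> carrier_vec n" using SQ colsQ by blast
  have in_span: "s \<in> span S" if s: "s \<in> set (cols Q)" for s
  proof (rule ccontr)
    assume ns: "s \<notin> span S"
    then have "s \<notin> S" using Sn span_mem by blast
    then have "lin_indpt (S \<union> {s})"
      using lin_dep_iff_in_span[OF Sn Sind] ns s colsQ by auto
    then have "S \<union> {s} \<subseteq> S" using S(2) s SQ unfolding maximal_def by blast
    with \<open>s \<notin> S\<close> show False by blast
  qed
  obtain xs where xs: "set xs = S" "distinct xs" using finite_distinct_list[OF S(1)] by blast
  have len: "length xs = r" using xs rS distinct_card by fastforce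
  define E where "E = mat_of_cols n xs"
  have E: "E \<in> carrier_mat n r" by (simp add: E_def len carrier_matI)
  have colsE: "cols E = xs" unfolding E_def by (rule cols_mat_of_cols) (simp add: xs Sn)
  have Einj: "v = 0\<^sub>v r" if "v \<in> carrier_vec r" "E *\<^sub>v v = 0\<^sub>v n" for v
    using lin_depI[OF E that(1) _ that(2)] Sind xs by (auto simp: colsE)
  obtain F where F: "F \<in> carrier_mat r l" "Q = E * F"
  proof (rule factor_through_columns[OF Q E])
    fix j assume "j < l"
    then have "col Q j \<in> set (cols Q)" using Q by (auto simp: cols_def)
    then have "col Q j \<in> col_space E" unfolding col_space_def using in_span xs colsE by auto
    then show "\<exists>x\<in>carrier_vec r. E *\<^sub>v x = col Q j"
      unfolding col_space_eq[OF E] using E by auto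
  qed
  obtain J where J: "J \<in> carrier_mat l r" "E = Q * J"
  proof (rule factor_through_columns[OF E Q])
    fix j assume j: "j < r"
    then have "col E j \<in> set (cols E)" using E by (auto simp: cols_def)
    then have "col E j \<in> set (cols Q)" using SQ xs colsE by auto
    then obtain i where i: "i < l" "col E j = col Q i" using Q by (auto simp: cols_def)
    have "Q *\<^sub>v unit_vec l i = col Q i" using Q i by (intro eq_vecI) auto
    then show "\<exists>x\<in>carrier_vec l. Q *\<^sub>v x = col E j" using i by (intro bexI[of _ "unit_vec l i"]) auto
  qed
  \<comment> \<open>\<open>E = Q J = E F J\<close>, and \<open>E\<close> is injective. The right
    inverse \<open>J\<close> of \<open>F\<close> makes the transpose of \<open>F\<close>
    injective.\<close>
  have FJ: "F * J = 1\<^sub>m r"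
  proof (rule mat_eq_by_vecs)
    fix v :: "real vec" assume v: "v \<in> carrier_vec r"
    have "E *\<^sub>v ((F * J) *\<^sub>v v - v) = (E * F * J) *\<^sub>v v - E *\<^sub>v v"
      using E F(1) J(1) v
      by (subst mult_minus_distrib_mat_vec[of _ n r]) (auto simp: mat_mult_vec_assoc_dim)
    also have "E * F * J = E" by (simp only: F(2)[symmetric] J(2)[symmetric])
    also have "E *\<^sub>v v - E *\<^sub>v v = 0\<^sub>v n" using E v by auto
    finally have z: "(F * J) *\<^sub>v v - v = 0\<^sub>v r" using v F(1) J(1) by (intro Einj) auto
    have "((F * J) *\<^sub>v v) $ i = v $ i" if "i < r" for i
      using arg_cong[OF z, of "\<lambda>u. u $ i"] that v by simp
    then show "(F * J) *\<^sub>v v = 1\<^sub>m r *\<^sub>v v" using v F(1) by (intro eq_vecI) auto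
  qed (use F J in auto)
  have Finj: "v = 0\<^sub>v r" if v: "v \<in> carrier_vec r" "transpose_mat F *\<^sub>v v = 0\<^sub>v l" for v
  proof -
    have "v = transpose_mat (F * J) *\<^sub>v v" using v by (simp add: FJ)
    also have "\<dots> = transpose_mat J *\<^sub>v (transpose_mat F *\<^sub>v v)"
      using F(1) J(1) v by (simp add: mat_transpose_mult_dim mat_mult_vec_assoc_dim)
    also have "\<dots> = 0\<^sub>v r" using J(1) unfolding v(2) by (intro eq_vecI) auto
    finally show ?thesis .
  qed
  from that[folded r_def, OF E F Einj Finj] show thesis by blast
qed

text \<open>Both \<open>Q X\<close> and \<open>Q Y\<close> are the orthogonal projection onto the
  range of \<open>Q\<close>, and both \<open>X Q\<close> and \<open>Y Q\<close> are the one onto its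
  row space. Hence \<open>X = X Q X = X Q Y = Y Q Y = Y\<close>.\<close>

lemma is_pseudoinverse_unique:
  assumes X: "is_pseudoinverse Q X" and Y: "is_pseudoinverse Q Y"
  shows "X = Y"
proof -
  define l n where "l = dim_col Q" and "n = dim_row Q"
  have d [simp]: "dim_row X = l" "dim_col X = n" "dim_row Y = l" "dim_col Y = n"
    "dim_row Q = n" "dim_col Q = l"
    using X Y by (auto simp: is_pseudoinverse_def l_def n_def)
  note x = X[unfolded is_pseudoinverse_def] and y = Y[unfolded is_pseudoinverse_def]
  have "Q * X = (Q * Y * Q) * X" using y by simp
  also have "\<dots> = (Q * Y) * (Q * X)" by (simp add: mat_mult_assoc_dim)
  finally have "transpose_mat (Q * X) = transpose_mat (Q * X) * transpose_mat (Q * Y)"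
    by (metis d mat_transpose_mult_dim index_mult_mat(2,3))
  then have "Q * X = Q * X * (Q * Y)" using x y by simp
  also have "\<dots> = Q * X * Q * Y" by (simp add: mat_mult_assoc_dim)
  finally have QX: "Q * X = Q * Y" using x by simp
  have "X * Q = X * (Q * Y * Q)" using y by simp
  also have "\<dots> = (X * Q) * (Y * Q)" by (simp add: mat_mult_assoc_dim)
  finally have "transpose_mat (X * Q) = transpose_mat (Y * Q) * transpose_mat (X * Q)"
    by (metis d mat_transpose_mult_dim index_mult_mat(2,3))
  then have "X * Q = Y * Q * (X * Q)" using x y by simp
  also have "\<dots> = Y * (Q * X * Q)" by (simp add: mat_mult_assoc_dim)
  finally have XQ: "X * Q = Y * Q" using x by simp
  have "X = X * (Q * X)" using x by (simp add: mat_mult_assoc_dim)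
  also have "\<dots> = (X * Q) * Y" unfolding QX by (simp add: mat_mult_assoc_dim)
  also have "\<dots> = Y" unfolding XQ using y by simp
  finally show ?thesis .
qed

lemma pseudoinverse_eqI: "is_pseudoinverse Q X \<Longrightarrow> pseudoinverse Q = X"
  unfolding pseudoinverse_def by (rule the_equality) (auto intro: is_pseudoinverse_unique)

text \<open>For a full rank factorization \<open>Q = E F\<close> the pseudoinverse is
  \<open>F\<^sup>T (F F\<^sup>T)\<^sup>-\<^sup>1 (E\<^sup>T E)\<^sup>-\<^sup>1 E\<^sup>T\<close>.
  The trace is recorded along with it because this is how the rank of \<open>A\<close> enters the
  estimate of the potential.\<close>

lemma pseudoinverse_exists_trace:
  assumes Q: "Q \<in> carrier_mat n l"
  shows "\<exists>X. is_pseudoinverse Q X \<and> mat_trace (Q * X) = real (vec_space.rank n Q)"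
proof -
  define r where "r = vec_space.rank n Q"
  obtain E F where E: "E \<in> carrier_mat n r" and F: "F \<in> carrier_mat r l" and QEF: "Q = E * F"
    and Einj: "\<And>v. v \<in> carrier_vec r \<Longrightarrow> E *\<^sub>v v = 0\<^sub>v n \<Longrightarrow> v = 0\<^sub>v r"
    and Finj: "\<And>v. v \<in> carrier_vec r \<Longrightarrow> transpose_mat F *\<^sub>v v = 0\<^sub>v l \<Longrightarrow> v = 0\<^sub>v r"
    unfolding r_def by (rule full_rank_factorization[OF Q]) blast
  obtain V where V: "V \<in> carrier_mat r r" "(transpose_mat E * E) * V = 1\<^sub>m r"
    "V * (transpose_mat E * E) = 1\<^sub>m r" "transpose_mat V = V"
    by (rule gram_mat_inverse[OF E Einj])
  have F': "transpose_mat F \<in> carrier_mat l r" using F by simp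
  obtain W where W: "W \<in> carrier_mat r r" "(transpose_mat (transpose_mat F) * transpose_mat F) * W = 1\<^sub>m r"
    "W * (transpose_mat (transpose_mat F) * transpose_mat F) = 1\<^sub>m r" "transpose_mat W = W"
    by (rule gram_mat_inverse[OF F' Finj])
  have d [simp]: "dim_row E = n" "dim_col E = r" "dim_row F = r" "dim_col F = l"
    "dim_row V = r" "dim_col V = r" "dim_row W = r" "dim_col W = r" using E F V W by auto
  \<comment> \<open>Products are normalized to the right, so the cancellation laws carry a trailing
    factor \<open>Z\<close>.\<close>
  have VE: "V * (transpose_mat E * (E * Z)) = Z" if "dim_row Z = r" for Z
    using arg_cong[OF V(3), of "\<lambda>M. M * Z"] that by (simp add: mat_mult_assoc_dim)
  have FW: "F * (transpose_mat F * (W * Z)) = Z" if "dim_row Z = r" for Z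
    using arg_cong[OF W(2), of "\<lambda>M. M * Z"] that by (simp add: mat_mult_assoc_dim)
  define X where "X = transpose_mat F * W * (V * transpose_mat E)"
  have QX: "Q * X = E * V * transpose_mat E"
    unfolding QEF X_def by (simp add: mat_mult_assoc_dim FW)
  have XQ: "X * Q = transpose_mat F * W * F"
    unfolding QEF X_def by (simp add: mat_mult_assoc_dim VE)
  have "is_pseudoinverse Q X"
    unfolding is_pseudoinverse_def
  proof (intro conjI)
    show "X \<in> carrier_mat (dim_col Q) (dim_row Q)" by (auto simp: X_def QEF)
    show "Q * X * Q = Q" unfolding QX unfolding QEF by (simp add: mat_mult_assoc_dim VE)
    show "X * Q * X = X" unfolding XQ unfolding X_def by (simp add: mat_mult_assoc_dim FW)
    show "transpose_mat (Q * X) = Q * X" unfolding QX by (simp add: mat_dim_algebra V(4))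
    show "transpose_mat (X * Q) = X * Q" unfolding XQ by (simp add: mat_dim_algebra W(4))
  qed
  moreover have "mat_trace (Q * X) = real r"
  proof -
    have "mat_trace (Q * X) = mat_trace (E * (V * transpose_mat E))"
      unfolding QX by (simp add: mat_mult_assoc_dim)
    also have "\<dots> = mat_trace (V * (transpose_mat E * E))"
      by (subst mat_trace_comm) (simp_all add: mat_mult_assoc_dim)
    finally show ?thesis using V(3) by (simp add: mat_trace_linear)
  qed
  ultimately show ?thesis unfolding r_def by blast
qed

lemma is_pseudoinverse_pseudoinverse: "is_pseudoinverse Q (pseudoinverse Q)"
  using pseudoinverse_exists_trace[of Q "dim_row Q" "dim_col Q"] pseudoinverse_eqI by auto

lemma mat_trace_mult_pseudoinverse:
  "Q \<in> carrier_mat n l \<Longrightarrow> mat_trace (Q * pseudoinverse Q) = real (vec_space.rank n Q)"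
  using pseudoinverse_exists_trace[of Q n l] pseudoinverse_eqI by auto

text \<open>In \<open>Q = E F\<close> the transpose of \<open>F\<close> is injective, so
  \<open>Q\<close> and \<open>E\<close> have transposes with the same kernel. It remains to see that
  \<open>E\<close>, which has a left inverse, is square exactly when its transpose is
  injective.\<close>

lemma rank_eq_dim_row_iff:
  fixes Q :: "real mat"
  assumes Q: "Q \<in> carrier_mat n l"
  shows "vec_space.rank n Q = n \<longleftrightarrow>
    (\<forall>v\<in>carrier_vec n. transpose_mat Q *\<^sub>v v = 0\<^sub>v l \<longrightarrow> v = 0\<^sub>v n)" (is "?L \<longleftrightarrow> ?R")
proof -
  define r where "r = vec_space.rank n Q"
  obtain E F where E: "E \<in> carrier_mat n r" and F: "F \<in> carrier_mat r l" and QEF: "Q = E * F"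
    and Einj: "\<And>v. v \<in> carrier_vec r \<Longrightarrow> E *\<^sub>v v = 0\<^sub>v n \<Longrightarrow> v = 0\<^sub>v r"
    and Finj: "\<And>v. v \<in> carrier_vec r \<Longrightarrow> transpose_mat F *\<^sub>v v = 0\<^sub>v l \<Longrightarrow> v = 0\<^sub>v r"
    unfolding r_def by (rule full_rank_factorization[OF Q]) blast
  have Qv: "transpose_mat Q *\<^sub>v v = transpose_mat F *\<^sub>v (transpose_mat E *\<^sub>v v)"
    if "v \<in> carrier_vec n" for v
    using that E F by (simp add: QEF mat_transpose_mult_dim mat_mult_vec_assoc_dim)
  obtain V where V: "V \<in> carrier_mat r r" "V * (transpose_mat E * E) = 1\<^sub>m r"
    using gram_mat_inverse[OF E Einj] by metis
  define L where "L = V * transpose_mat E"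
  have L: "L \<in> carrier_mat r n" "L * E = 1\<^sub>m r"
    using V E by (auto simp: L_def mat_mult_assoc_dim)
  show ?thesis
  proof
    assume ?L
    then have rn: "r = n" by (simp add: r_def)
    have EL: "E * L = 1\<^sub>m n" using mat_mult_left_right_inverse[of L n E] L E rn by auto
    show ?R
    proof (intro ballI impI)
      fix v assume v: "v \<in> carrier_vec n" "transpose_mat Q *\<^sub>v v = 0\<^sub>v l"
      then have Ev: "transpose_mat E *\<^sub>v v = 0\<^sub>v r" using Qv E by (intro Finj) auto
      have "v = transpose_mat (E * L) *\<^sub>v v" using v by (simp add: EL)
      also have "\<dots> = transpose_mat L *\<^sub>v (transpose_mat E *\<^sub>v v)"
        using E L v by (simp add: mat_transpose_mult_dim mat_mult_vec_assoc_dim)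
      also have "\<dots> = 0\<^sub>v n" using L(1) unfolding Ev by (intro eq_vecI) auto
      finally show "v = 0\<^sub>v n" .
    qed
  next
    assume R: ?R
    have E': "transpose_mat E \<in> carrier_mat r n" using E by simp
    have "v = 0\<^sub>v n" if "v \<in> carrier_vec n" "transpose_mat E *\<^sub>v v = 0\<^sub>v r" for v
    proof -
      have "transpose_mat Q *\<^sub>v v = 0\<^sub>v l"
        unfolding Qv[OF that(1)] that(2) using F by (intro eq_vecI) auto
      with R that show ?thesis by blast
    qed
    then obtain W where W: "W \<in> carrier_mat n n"
      "(transpose_mat (transpose_mat E) * transpose_mat E) * W = 1\<^sub>m n"
      using gram_mat_inverse[OF E'] by metis
    define R where "R = transpose_mat E * W"
    have R: "R \<in> carrier_mat r n" "E * R = 1\<^sub>m n"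
      using W E by (auto simp: R_def mat_mult_assoc_dim)
    \<comment> \<open>A left inverse and a right inverse of \<open>E\<close> coincide; the traces of
      \<open>E L = 1\<close> and \<open>L E = 1\<close> then show that \<open>E\<close> is
      square.\<close>
    have "L = L * (E * R)" using L by (simp add: R(2))
    also have "\<dots> = (L * E) * R" using L(1) E R(1) by (simp add: mat_mult_assoc_dim)
    also have "\<dots> = R" using R(1) by (simp add: L(2))
    finally have "mat_trace (E * L) = real n" using R(2) by (simp add: mat_trace_linear)
    moreover have "mat_trace (E * L) = mat_trace (L * E)" using E L(1) by (simp add: mat_trace_comm)
    ultimately have "real r = real n" by (simp add: L(2) mat_trace_linear)
    then show ?L by (simp add: r_def)
  qed
qed

section \<open>Comparison of pseudoinverse norms through Gram matrices\<close>

lemma real_young_ineq: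
  fixes s t a :: real
  assumes "0 < a"
  shows "2 * (s * t) \<le> a * s\<^sup>2 + t\<^sup>2 / a"
proof -
  have "0 \<le> (a * s - t)\<^sup>2 / a" using assms by simp
  also have "\<dots> = a * s\<^sup>2 + t\<^sup>2 / a - 2 * (s * t)"
    using assms by (simp add: field_simps power2_eq_square)
  finally show ?thesis by simp
qed

lemma real_scalar_prod_young:
  fixes x y :: "real vec"
  assumes "dim_vec x = dim_vec y" "0 < a"
  shows "2 * (x \<bullet> y) \<le> a * (x \<bullet> x) + (y \<bullet> y) / a"
proof -
  have "(\<Sum>i<dim_vec y. 2 * (x $ i * y $ i))
      \<le> (\<Sum>i<dim_vec y. a * (x $ i)\<^sup>2 + (y $ i)\<^sup>2 / a)"
    by (intro sum_mono real_young_ineq assms)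
  then show ?thesis using assms
    by (simp add: power2_eq_square scalar_prod_def atLeast0LessThan sum.distrib sum_distrib_left sum_divide_distrib)
qed

lemma gram_quadratic_form:
  fixes X :: "real mat"
  assumes "X \<in> carrier_mat n p" "u \<in> carrier_vec n" "v \<in> carrier_vec n"
  shows "u \<bullet> ((X * transpose_mat X) *\<^sub>v v) = (transpose_mat X *\<^sub>v u) \<bullet> (transpose_mat X *\<^sub>v v)"
  using assms by (simp add: mat_mult_vec_assoc_dim scalar_prod_mult_mat_vec_dim)

lemma pseudoinverse_full_row_rank:
  assumes Q: "Q \<in> carrier_mat n p" and W: "W \<in> carrier_mat n n"
    and QW: "(Q * transpose_mat Q) * W = 1\<^sub>m n" and WQ: "W * (Q * transpose_mat Q) = 1\<^sub>m n"
    and sym: "transpose_mat W = W"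
  shows "pseudoinverse Q = transpose_mat Q * W"
proof (rule pseudoinverse_eqI)
  have d [simp]: "dim_row Q = n" "dim_col Q = p" "dim_row W = n" "dim_col W = n" using Q W by auto
  have c: "Q * (transpose_mat Q * (W * Z)) = Z" if "dim_row Z = n" for Z
    using arg_cong[OF QW, of "\<lambda>M. M * Z"] that by (simp add: mat_mult_assoc_dim)
  show "is_pseudoinverse Q (transpose_mat Q * W)"
    unfolding is_pseudoinverse_def
    using QW by (auto simp: mat_dim_algebra c sym)
qed

lemma pseudoinverse_full_row_rank_norm:
  assumes Q: "Q \<in> carrier_mat n p" and W: "W \<in> carrier_mat n n"
    and QW: "(Q * transpose_mat Q) * W = 1\<^sub>m n" and WQ: "W * (Q * transpose_mat Q) = 1\<^sub>m n"
    and sym: "transpose_mat W = W" and v: "v \<in> carrier_vec n"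
  shows "(pseudoinverse Q *\<^sub>v v) \<bullet> (pseudoinverse Q *\<^sub>v v) = (W *\<^sub>v v) \<bullet> v"
proof -
  have "pseudoinverse Q *\<^sub>v v = transpose_mat Q *\<^sub>v (W *\<^sub>v v)"
    unfolding pseudoinverse_full_row_rank[OF Q W QW WQ sym]
    using Q W v by (simp add: mat_mult_vec_assoc_dim)
  then have "(pseudoinverse Q *\<^sub>v v) \<bullet> (pseudoinverse Q *\<^sub>v v)
      = (W *\<^sub>v v) \<bullet> ((Q * transpose_mat Q) *\<^sub>v (W *\<^sub>v v))"
    using gram_quadratic_form[OF Q, of "W *\<^sub>v v" "W *\<^sub>v v"] W v by simp
  also have "(Q * transpose_mat Q) *\<^sub>v (W *\<^sub>v v) = (Q * transpose_mat Q * W) *\<^sub>v v"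
    using Q W v by (simp add: mat_mult_vec_assoc_dim)
  finally show ?thesis using v by (simp add: QW)
qed

lemma gram_inverse_of_full_row_rank:
  fixes Q :: "real mat"
  assumes Q: "Q \<in> carrier_mat n p" and r: "vec_space.rank n Q = n"
  obtains W where "W \<in> carrier_mat n n" "(Q * transpose_mat Q) * W = 1\<^sub>m n"
    "W * (Q * transpose_mat Q) = 1\<^sub>m n" "transpose_mat W = W"
proof -
  have Q': "transpose_mat Q \<in> carrier_mat p n" using Q by simp
  have inj: "\<And>v. v \<in> carrier_vec n \<Longrightarrow> transpose_mat Q *\<^sub>v v = 0\<^sub>v p \<Longrightarrow> v = 0\<^sub>v n"
    using r rank_eq_dim_row_iff[OF Q] by blast
  from gram_mat_inverse[OF Q' inj] that show thesis by (metis transpose_transpose)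
qed

lemma frobenius_norm_square_columns:
  assumes X: "X \<in> carrier_mat p n"
  shows "(frobenius_norm X)\<^sup>2 = (\<Sum>j<n. (X *\<^sub>v unit_vec n j) \<bullet> (X *\<^sub>v unit_vec n j))"
proof -
  have "(X *\<^sub>v unit_vec n j) \<bullet> (X *\<^sub>v unit_vec n j) = (\<Sum>i<p. (X $$ (i, j))\<^sup>2)" if "j < n" for j
    using X that by (simp add: scalar_prod_def[of "X *\<^sub>v _"] atLeast0LessThan power2_eq_square)
  then show ?thesis unfolding frobenius_norm_square using X by (simp add: sum.swap[of _ "{..<p}"])
qed

lemma frobenius_norm_square_mono:
  assumes X: "X \<in> carrier_mat p n" and Y: "Y \<in> carrier_mat q n"
    and le: "\<And>v. v \<in> carrier_vec n \<Longrightarrow> (X *\<^sub>v v) \<bullet> (X *\<^sub>v v) \<le> \<kappa> * ((Y *\<^sub>v v) \<bullet> (Y *\<^sub>v v))"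
  shows "(frobenius_norm X)\<^sup>2 \<le> \<kappa> * (frobenius_norm Y)\<^sup>2"
  unfolding frobenius_norm_square_columns[OF X] frobenius_norm_square_columns[OF Y] sum_distrib_left
  by (intro sum_mono le) simp

text \<open>A real \<open>SUP\<close> is an upper bound only over a bounded set. Entries of vectors
  in the unit ball are at most 1 in absolute value, so absolute row sums give a crude bound.\<close>

lemma bdd_above_spectral_norm:
  "bdd_above ((\<lambda>v. euclidean_norm_vec (X *\<^sub>v v)) ` {v \<in> carrier_vec (dim_col X). euclidean_norm_vec v \<le> 1})"
proof (rule bdd_aboveI2)
  fix v assume "v \<in> {v \<in> carrier_vec (dim_col X). euclidean_norm_vec v \<le> 1}"
  then have v: "v \<in> carrier_vec (dim_col X)" "euclidean_norm_vec v \<le> 1" by auto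
  have entry: "\<bar>v $ j\<bar> \<le> 1" if "j < dim_col X" for j
  proof -
    have "(v $ j)\<^sup>2 \<le> (\<Sum>i<dim_vec v. (v $ i)\<^sup>2)" using that v by (intro member_le_sum) auto
    also have "\<dots> \<le> 1" using v(2) by (simp add: euclidean_norm_vec_def)
    finally show ?thesis by (simp add: abs_square_le_1)
  qed
  have "\<bar>(X *\<^sub>v v) $ i\<bar> \<le> (\<Sum>j<dim_col X. \<bar>X $$ (i, j)\<bar>)" if "i < dim_row X" for i
  proof -
    have "\<bar>(X *\<^sub>v v) $ i\<bar> = \<bar>\<Sum>j<dim_col X. X $$ (i, j) * v $ j\<bar>"
      using that v by (simp add: scalar_prod_def atLeast0LessThan)
    also have "\<dots> \<le> (\<Sum>j<dim_col X. \<bar>X $$ (i, j) * v $ j\<bar>)" by (rule sum_abs)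
    also have "\<dots> \<le> (\<Sum>j<dim_col X. \<bar>X $$ (i, j)\<bar>)"
      using entry by (intro sum_mono) (simp add: abs_mult mult_left_le)
    finally show ?thesis .
  qed
  then have "(\<Sum>i<dim_row X. ((X *\<^sub>v v) $ i)\<^sup>2) \<le> (\<Sum>i<dim_row X. (\<Sum>j<dim_col X. \<bar>X $$ (i, j)\<bar>)\<^sup>2)"
    by (intro sum_mono) (simp add: abs_le_square_iff[symmetric] sum_nonneg)
  then show "euclidean_norm_vec (X *\<^sub>v v) \<le> sqrt (\<Sum>i<dim_row X. (\<Sum>j<dim_col X. \<bar>X $$ (i, j)\<bar>)\<^sup>2)"
    by (simp add: euclidean_norm_vec_def)
qed

lemma euclidean_norm_vec_nonneg: "0 \<le> euclidean_norm_vec v"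
  by (simp add: euclidean_norm_vec_def sum_nonneg)

lemma zero_vec_in_unit_ball: "0\<^sub>v d \<in> {v \<in> carrier_vec d. euclidean_norm_vec v \<le> 1}"
  by (simp add: euclidean_norm_vec_def)

lemma spectral_norm_square_mono:
  assumes X: "X \<in> carrier_mat p n" and Y: "Y \<in> carrier_mat q n" and \<kappa>: "0 \<le> \<kappa>"
    and le: "\<And>v. v \<in> carrier_vec n \<Longrightarrow> (X *\<^sub>v v) \<bullet> (X *\<^sub>v v) \<le> \<kappa> * ((Y *\<^sub>v v) \<bullet> (Y *\<^sub>v v))"
  shows "(spectral_norm X)\<^sup>2 \<le> \<kappa> * (spectral_norm Y)\<^sup>2"
proof -
  have dX: "dim_col X = n" and dY: "dim_col Y = n" using X Y by auto
  have "spectral_norm X \<le> sqrt \<kappa> * spectral_norm Y"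
    unfolding spectral_norm_def[of X]
  proof (rule cSUP_least)
    show "{v \<in> carrier_vec (dim_col X). euclidean_norm_vec v \<le> 1} \<noteq> {}"
      using zero_vec_in_unit_ball by blast
    fix v assume v: "v \<in> {v \<in> carrier_vec (dim_col X). euclidean_norm_vec v \<le> 1}"
    have "(euclidean_norm_vec (X *\<^sub>v v))\<^sup>2 \<le> \<kappa> * (euclidean_norm_vec (Y *\<^sub>v v))\<^sup>2"
      using le v dX by (simp add: euclidean_norm_vec_square)
    then have "euclidean_norm_vec (X *\<^sub>v v) \<le> sqrt \<kappa> * euclidean_norm_vec (Y *\<^sub>v v)"
      by (metis real_le_rsqrt real_sqrt_mult real_sqrt_abs abs_of_nonneg euclidean_norm_vec_nonneg)
    also have "euclidean_norm_vec (Y *\<^sub>v v) \<le> spectral_norm Y"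
      unfolding spectral_norm_def using v dX dY by (intro cSUP_upper bdd_above_spectral_norm) simp
    finally show "euclidean_norm_vec (X *\<^sub>v v) \<le> sqrt \<kappa> * spectral_norm Y"
      using \<kappa> by (simp add: mult_left_mono)
  qed
  moreover have "0 \<le> spectral_norm X"
  proof -
    have "0 \<le> euclidean_norm_vec (X *\<^sub>v 0\<^sub>v (dim_col X))" by (rule euclidean_norm_vec_nonneg)
    also have "\<dots> \<le> spectral_norm X"
      unfolding spectral_norm_def by (intro cSUP_upper bdd_above_spectral_norm zero_vec_in_unit_ball)
    finally show ?thesis .
  qed
  ultimately have "(spectral_norm X)\<^sup>2 \<le> (sqrt \<kappa> * spectral_norm Y)\<^sup>2" by (intro power_mono)
  then show ?thesis using \<kappa> by (simp add: power_mult_distrib)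
qed

text \<open>Inversion reverses the Loewner order. For
  \<open>u = (Q Q\<^sup>T)\<^sup>-\<^sup>1 v\<close> and
  \<open>z = (C C\<^sup>T)\<^sup>-\<^sup>1 v\<close>, Young's inequality with weight
  \<open>c\<close> bounds \<open>2 (u \<bullet> v)\<close>, the doubled product of
  \<open>C\<^sup>T u\<close> and \<open>C\<^sup>T z\<close>, by
  \<open>u \<bullet> v + (z \<bullet> v) / c\<close>. These forms are the squared norms of the two
  pseudoinverses applied to \<open>v\<close>.\<close>

lemma pseudoinverse_norm_comparison:
  fixes Q C :: "real mat"
  assumes Q: "Q \<in> carrier_mat n p" and C: "C \<in> carrier_mat n q" and c: "0 < c"
    and rC: "vec_space.rank n C = n"
    and le: "\<And>y. y \<in> carrier_vec n \<Longrightarrow>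
      c * ((transpose_mat C *\<^sub>v y) \<bullet> (transpose_mat C *\<^sub>v y)) \<le> (transpose_mat Q *\<^sub>v y) \<bullet> (transpose_mat Q *\<^sub>v y)"
  shows "vec_space.rank n Q = n"
    and "\<forall>mat_norm \<in> {spectral_norm, frobenius_norm}.
      (mat_norm (pseudoinverse Q))\<^sup>2 \<le> 1 / c * (mat_norm (pseudoinverse C))\<^sup>2"
proof -
  show rQ: "vec_space.rank n Q = n"
    unfolding rank_eq_dim_row_iff[OF Q]
  proof (intro ballI impI)
    fix v assume v: "v \<in> carrier_vec n" "transpose_mat Q *\<^sub>v v = 0\<^sub>v p"
    have "c * ((transpose_mat C *\<^sub>v v) \<bullet> (transpose_mat C *\<^sub>v v)) \<le> 0" using le[OF v(1)] v(2) by simp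
    then have "(transpose_mat C *\<^sub>v v) \<bullet> (transpose_mat C *\<^sub>v v) = 0"
      using c real_scalar_prod_self(1)[of "transpose_mat C *\<^sub>v v"]
      by (metis antisym mult_le_cancel_left_pos mult_zero_right)
    then have "transpose_mat C *\<^sub>v v = 0\<^sub>v q" using real_scalar_prod_self(2) C by fastforce
    then show "v = 0\<^sub>v n" using rC v(1) rank_eq_dim_row_iff[OF C] by blast
  qed
  obtain W where W: "W \<in> carrier_mat n n" "(Q * transpose_mat Q) * W = 1\<^sub>m n"
    "W * (Q * transpose_mat Q) = 1\<^sub>m n" "transpose_mat W = W"
    by (rule gram_inverse_of_full_row_rank[OF Q rQ])
  obtain Z where Z: "Z \<in> carrier_mat n n" "(C * transpose_mat C) * Z = 1\<^sub>m n"
    "Z * (C * transpose_mat C) = 1\<^sub>m n" "transpose_mat Z = Z"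
    by (rule gram_inverse_of_full_row_rank[OF C rC])
  have comp: "(pseudoinverse Q *\<^sub>v v) \<bullet> (pseudoinverse Q *\<^sub>v v)
      \<le> 1 / c * ((pseudoinverse C *\<^sub>v v) \<bullet> (pseudoinverse C *\<^sub>v v))" if v: "v \<in> carrier_vec n" for v
  proof -
    define u z where "u = W *\<^sub>v v" and "z = Z *\<^sub>v v"
    have uz: "u \<in> carrier_vec n" "z \<in> carrier_vec n" using W Z v by (auto simp: u_def z_def)
    have Qu: "(Q * transpose_mat Q) *\<^sub>v u = v"
    proof -
      have "(Q * transpose_mat Q) *\<^sub>v u = (Q * transpose_mat Q * W) *\<^sub>v v"
        using Q W(1) v by (simp add: u_def mat_mult_vec_assoc_dim)
      then show ?thesis using v by (simp add: W(2))
    qed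
    have Cz: "(C * transpose_mat C) *\<^sub>v z = v"
    proof -
      have "(C * transpose_mat C) *\<^sub>v z = (C * transpose_mat C * Z) *\<^sub>v v"
        using C Z(1) v by (simp add: z_def mat_mult_vec_assoc_dim)
      then show ?thesis using v by (simp add: Z(2))
    qed
    let ?Cu = "transpose_mat C *\<^sub>v u" and ?Cz = "transpose_mat C *\<^sub>v z"
    have "2 * (u \<bullet> v) = 2 * (?Cu \<bullet> ?Cz)" using gram_quadratic_form[OF C uz] by (simp add: Cz)
    also have "\<dots> \<le> c * (?Cu \<bullet> ?Cu) + (?Cz \<bullet> ?Cz) / c"
      using c by (intro real_scalar_prod_young) auto
    also have "?Cz \<bullet> ?Cz = z \<bullet> v" using gram_quadratic_form[OF C uz(2) uz(2)] by (simp add: Cz)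
    also have "c * (?Cu \<bullet> ?Cu) \<le> u \<bullet> v"
      using le[OF uz(1)] gram_quadratic_form[OF Q uz(1) uz(1)] by (simp add: Qu)
    finally have "u \<bullet> v \<le> 1 / c * (z \<bullet> v)" by simp
    then show ?thesis
      using pseudoinverse_full_row_rank_norm[OF Q W v] pseudoinverse_full_row_rank_norm[OF C Z v]
      by (simp add: u_def z_def)
  qed
  have X: "pseudoinverse Q \<in> carrier_mat p n" "pseudoinverse C \<in> carrier_mat q n"
    using is_pseudoinverse_pseudoinverse[of Q] is_pseudoinverse_pseudoinverse[of C] Q C
    by (auto simp: is_pseudoinverse_def)
  show "\<forall>mat_norm \<in> {spectral_norm, frobenius_norm}.
      (mat_norm (pseudoinverse Q))\<^sup>2 \<le> 1 / c * (mat_norm (pseudoinverse C))\<^sup>2"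
    using spectral_norm_square_mono[OF X _ comp] frobenius_norm_square_mono[OF X comp] c by auto
qed

section \<open>Concatenation and column selection\<close>

lemma hconcat_carrier:
  "A \<in> carrier_mat n l \<Longrightarrow> B \<in> carrier_mat n m \<Longrightarrow> hconcat A B \<in> carrier_mat n (l + m)"
  by (auto simp: hconcat_def)

lemma hconcat_gram:
  fixes A B :: "real mat"
  assumes A: "A \<in> carrier_mat n l" and B: "B \<in> carrier_mat n m"
  shows "hconcat A B * transpose_mat (hconcat A B) = A * transpose_mat A + B * transpose_mat B"
proof (rule eq_matI)
  fix i j assume "i < dim_row (A * transpose_mat A + B * transpose_mat B)"
    "j < dim_col (A * transpose_mat A + B * transpose_mat B)"
  then have ij: "i < n" "j < n" using A B by auto
  have row: "row (hconcat A B) i = row A i @\<^sub>v row B i" if "i < n" for i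
    using A B that by (intro eq_vecI) (auto simp: hconcat_def)
  have "(hconcat A B * transpose_mat (hconcat A B)) $$ (i, j) = row (hconcat A B) i \<bullet> row (hconcat A B) j"
    using ij hconcat_carrier[OF A B] by simp
  also have "\<dots> = row A i \<bullet> row A j + row B i \<bullet> row B j"
    unfolding row[OF ij(1)] row[OF ij(2)] using A B by (intro scalar_prod_append[of _ l _ m]) auto
  finally show "(hconcat A B * transpose_mat (hconcat A B)) $$ (i, j)
      = (A * transpose_mat A + B * transpose_mat B) $$ (i, j)" using A B ij by simp
qed (use A B in \<open>auto simp: hconcat_def\<close>)

lemma hconcat_transpose_mult_norm:
  fixes A B :: "real mat"
  assumes A: "A \<in> carrier_mat n l" and B: "B \<in> carrier_mat n m" and v: "v \<in> carrier_vec n"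
  shows "(transpose_mat (hconcat A B) *\<^sub>v v) \<bullet> (transpose_mat (hconcat A B) *\<^sub>v v)
    = (transpose_mat A *\<^sub>v v) \<bullet> (transpose_mat A *\<^sub>v v)
      + (transpose_mat B *\<^sub>v v) \<bullet> (transpose_mat B *\<^sub>v v)"
proof -
  have "v \<bullet> ((A * transpose_mat A + B * transpose_mat B) *\<^sub>v v)
      = v \<bullet> ((A * transpose_mat A) *\<^sub>v v) + v \<bullet> ((B * transpose_mat B) *\<^sub>v v)"
    using A B v
    by (subst add_mult_distrib_mat_vec[of _ n n]) (auto simp: scalar_prod_add_distrib[of _ n])
  then show ?thesis
    by (simp only: gram_quadratic_form[OF hconcat_carrier[OF A B] v v, symmetric]
        gram_quadratic_form[OF A v v] gram_quadratic_form[OF B v v] hconcat_gram[OF A B])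
qed

lemma pick_bij_betw:
  assumes "finite S"
  shows "bij_betw (pick S) {..<card S} S"
proof -
  have "inj_on (pick S) {..<card S}"
    by (intro inj_onI) (metis lessThan_iff nat_neq_iff pick_mono_le)
  moreover have "pick S ` {..<card S} \<subseteq> S" using pick_in_set_le by auto
  ultimately show ?thesis
    using assms by (metis bij_betw_def card_image card_lessThan card_subset_eq)
qed

lemma col_submatrix_carrier:
  assumes B: "B \<in> carrier_mat n m" and S: "S \<subseteq> {0..<m}"
  shows "col_submatrix B S \<in> carrier_mat n (card S)"
proof -
  have "{j. j < m \<and> j \<in> S} = S" using S by auto
  then show ?thesis using B by (intro carrier_matI) (simp_all add: col_submatrix_def dim_submatrix)
qed

lemma col_submatrix_transpose_mult_norm:
  fixes B :: "real mat"
  assumes B: "B \<in> carrier_mat n m" and S: "S \<subseteq> {0..<m}" and v: "v \<in> carrier_vec n"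
  shows "(transpose_mat (col_submatrix B S) *\<^sub>v v) \<bullet> (transpose_mat (col_submatrix B S) *\<^sub>v v)
    = (\<Sum>j\<in>S. ((transpose_mat B *\<^sub>v v) $ j)\<^sup>2)"
proof -
  have fin: "finite S" using S finite_subset by blast
  have SS: "{j. j < m \<and> j \<in> S} = S" using S by auto
  note C = col_submatrix_carrier[OF B S]
  have col: "(transpose_mat (col_submatrix B S) *\<^sub>v v) $ j = (transpose_mat B *\<^sub>v v) $ pick S j"
    if j: "j < card S" for j
  proof -
    have p: "pick S j < m" using pick_in_set_le[OF j] S by auto
    have "col (col_submatrix B S) j = col B (pick S j)"
      using B C j p SS pick_UNIV
      by (intro eq_vecI) (auto simp: col_submatrix_def submatrix_index)
    then show ?thesis using B C j p by simp
  qed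
  have "(transpose_mat (col_submatrix B S) *\<^sub>v v) \<bullet> (transpose_mat (col_submatrix B S) *\<^sub>v v)
      = (\<Sum>j<card S. ((transpose_mat B *\<^sub>v v) $ pick S j)\<^sup>2)"
    using C by (simp add: scalar_prod_def[of "transpose_mat (col_submatrix B S) *\<^sub>v v"]
        atLeast0LessThan col power2_eq_square del: index_mult_mat_vec)
  also have "\<dots> = (\<Sum>j\<in>S. ((transpose_mat B *\<^sub>v v) $ j)\<^sup>2)"
    by (rule sum.reindex_bij_betw[OF pick_bij_betw[OF fin]])
  finally show ?thesis .
qed

subsection \<open>The initial potential\<close>

text \<open>In terms of \<open>s = N + m w / h\<close> the value \<open>w - K / \<phi>\<close> is an affine function of
  \<open>(m - K) s + N K (m - N) / s\<close>, to which AM-GM applies; its infimum is not attained when \<open>K = m\<close>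
  or \<open>N = 0\<close>.\<close>

lemma barrier_optimum:
  fixes N K m h \<epsilon> :: real
  assumes N: "0 \<le> N" "N < K" "K \<le> m" and h: "0 < h" and \<epsilon>: "0 < \<epsilon>"
  shows "\<exists>w \<delta>. 0 < w \<and> 0 \<le> \<delta> \<and> \<delta> * (N / w + (m - N) / (w + h)) < 1 \<and>
    w - K * \<delta> \<le> \<epsilon> - h * (sqrt (K * (m - N)) - sqrt (N * (m - K)))\<^sup>2 / m\<^sup>2"
proof -
  define \<alpha> \<beta> where "\<alpha> = m - K" and "\<beta> = N * K * (m - N)"
  \<comment> \<open>Scaled so that an error \<eta> in the AM-GM value costs
    \<open>\<epsilon> / 2\<close> in the result; the other half is spent on \<delta>.\<close>
  define \<eta> where "\<eta> = \<epsilon> * m\<^sup>2 / (2 * h)"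
  have m: "0 < m" "0 < K" using N by auto
  have \<eta>: "0 < \<eta>" using \<epsilon> h m by (simp add: \<eta>_def)
  have nonneg: "0 \<le> \<alpha>" "0 \<le> \<beta>" using N by (auto simp: \<alpha>_def \<beta>_def)
  have "\<exists>s>N. \<alpha> * s + \<beta> / s \<le> 2 * sqrt (\<alpha> * \<beta>) + \<eta>"
  proof -
    \<comment> \<open>For \<alpha> = 0 (\<open>K = m\<close>) a large \<open>s\<close> is needed,
      for \<beta> = 0 (\<open>N = 0\<close>) a small one. Otherwise the minimizer
      \<open>sqrt (\<beta> / \<alpha>)\<close> is available.\<close>
    consider "\<alpha> = 0" | "\<beta> = 0" | "0 < \<alpha>" "0 < \<beta>" using nonneg by linarith
    then show ?thesis
    proof cases
      case 1
      have "\<beta> / (N + 1 + \<beta> / \<eta>) \<le> \<eta>"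
      proof -
        have "\<beta> \<le> \<eta> * (N + 1 + \<beta> / \<eta>)" using \<eta> N by (simp add: algebra_simps)
        moreover have "0 < N + 1 + \<beta> / \<eta>" using \<eta> N nonneg by (simp add: add_pos_nonneg)
        ultimately show ?thesis by (simp add: divide_le_eq)
      qed
      moreover have "N < N + 1 + \<beta> / \<eta>" using \<eta> nonneg by (simp add: add_pos_nonneg)
      ultimately show ?thesis using 1 by (intro exI[of _ "N + 1 + \<beta> / \<eta>"]) simp
    next
      case 2
      then have "N = 0" using N m by (auto simp: \<beta>_def)
      moreover have "\<alpha> * (\<eta> / (\<alpha> + 1)) \<le> \<eta>" using nonneg \<eta> by (simp add: field_simps)
      ultimately show ?thesis using 2 \<eta> nonneg by (intro exI[of _ "\<eta> / (\<alpha> + 1)"]) simp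
    next
      case 3
      \<comment> \<open>The minimizer is admissible because
        \<open>N * (m - K) < K * (m - N)\<close>, which is \<open>N < K\<close> scaled by
        \<open>m\<close>.\<close>
      have "N < sqrt (\<beta> / \<alpha>)"
      proof (rule real_less_rsqrt)
        have "N \<noteq> 0" using 3(2) by (auto simp: \<beta>_def)
        then have "N * (N * (m - K)) < N * (K * (m - N))"
          using N m by (intro mult_strict_left_mono) (auto simp: algebra_simps)
        then show "N\<^sup>2 < \<beta> / \<alpha>"
          using 3 by (simp add: \<alpha>_def \<beta>_def pos_less_divide_eq power2_eq_square mult.assoc)
      qed
      moreover have "\<alpha> * sqrt (\<beta> / \<alpha>) = sqrt (\<alpha> * \<beta>)"
        using 3 by (simp add: real_sqrt_divide real_sqrt_mult field_simps)
      moreover have "\<beta> / sqrt (\<beta> / \<alpha>) = sqrt (\<alpha> * \<beta>)"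
        using 3 by (simp add: real_sqrt_divide real_sqrt_mult field_simps)
      ultimately show ?thesis using \<eta> by (intro exI[of _ "sqrt (\<beta> / \<alpha>)"]) simp
    qed
  qed
  then obtain s where s: "N < s" "\<alpha> * s + \<beta> / s \<le> 2 * sqrt (\<alpha> * \<beta>) + \<eta>" by blast
  \<comment> \<open>Solves \<open>s = N + m w / h\<close> for \<open>w\<close>, so that
    \<open>N < s\<close> becomes \<open>0 < w\<close>.\<close>
  define w where "w = h * (s - N) / m"
  define \<phi> where "\<phi> = N / w + (m - N) / (w + h)"
  have w: "0 < w" using s h m by (simp add: w_def)
  have s0: "0 < s" using s N by simp
  have wh: "w + h = h * (s - N + m) / m" using m by (simp add: w_def field_simps)
  have smN: "0 < s - N + m" using s m by simp
  have \<phi>: "\<phi> = m\<^sup>2 * s / (h * (s - N) * (s - N + m))"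
    unfolding \<phi>_def wh unfolding w_def using s h m smN
    by (simp add: divide_simps) (simp add: algebra_simps power2_eq_square)
  have \<phi>0: "0 < \<phi>" unfolding \<phi> using s h m s0 smN by simp
  have val: "w - K / \<phi> = h * (\<alpha> * s + \<beta> / s - N * (m - K) - K * (m - N)) / m\<^sup>2"
    unfolding \<phi> \<alpha>_def \<beta>_def w_def using s0 m h
    by (simp add: divide_simps) (simp add: algebra_simps power2_eq_square)
  have sq: "(sqrt (K * (m - N)) - sqrt (N * (m - K)))\<^sup>2
      = K * (m - N) + N * (m - K) - 2 * sqrt (\<alpha> * \<beta>)"
  proof -
    have "(sqrt (K * (m - N)) - sqrt (N * (m - K)))\<^sup>2
        = K * (m - N) + N * (m - K) - 2 * (sqrt (K * (m - N)) * sqrt (N * (m - K)))"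
      using N m by (simp add: power2_diff)
    also have "sqrt (K * (m - N)) * sqrt (N * (m - K)) = sqrt (\<alpha> * \<beta>)"
      unfolding real_sqrt_mult[symmetric] by (simp add: \<alpha>_def \<beta>_def algebra_simps)
    finally show ?thesis .
  qed
  have "w - K / \<phi> \<le> h * (2 * sqrt (\<alpha> * \<beta>) + \<eta> - N * (m - K) - K * (m - N)) / m\<^sup>2"
    unfolding val using s(2) h by (intro divide_right_mono mult_left_mono) auto
  also have "\<dots> = \<epsilon> / 2 - h * (sqrt (K * (m - N)) - sqrt (N * (m - K)))\<^sup>2 / m\<^sup>2"
    unfolding sq \<eta>_def using h m by (simp add: field_simps)
  finally have le: "w - K / \<phi> \<le> \<epsilon> / 2 - h * (sqrt (K * (m - N)) - sqrt (N * (m - K)))\<^sup>2 / m\<^sup>2" .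
  \<comment> \<open>Slightly less than \<open>1 / \<phi>\<close>, for the strict condition
    \<open>\<delta> * \<phi> < 1\<close>; the deficit times \<open>K\<close> is at most
    \<open>\<epsilon> / 2\<close>. The maximum keeps \<delta> nonnegative when \<epsilon> is
    large.\<close>
  define \<delta> where "\<delta> = max 0 (1 / \<phi> - \<epsilon> / (2 * K))"
  have "\<delta> < 1 / \<phi>" using \<phi>0 \<epsilon> m by (simp add: \<delta>_def)
  then have "\<delta> * \<phi> < 1" using \<phi>0 by (simp add: pos_less_divide_eq)
  moreover have "K * (1 / \<phi> - \<epsilon> / (2 * K)) \<le> K * \<delta>"
    using m by (intro mult_left_mono) (auto simp: \<delta>_def)
  then have "w - K * \<delta> \<le> w - K / \<phi> + \<epsilon> / 2" using m by (simp add: right_diff_distrib)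
  ultimately show ?thesis using w le
    by (intro exI[of _ w] exI[of _ \<delta>]) (auto simp: \<delta>_def \<phi>_def)
qed

text \<open>The barrier yields a set \<open>T\<close> that may depend on \<epsilon>. If each of
  finitely many sets failed at some \<epsilon> of its own, all would fail at the smallest of
  these.\<close>

lemma finite_family_uniform_limit:
  fixes P :: "'a \<Rightarrow> real \<Rightarrow> bool"
  assumes fin: "finite F" and ex: "\<And>\<epsilon>. 0 < \<epsilon> \<Longrightarrow> \<exists>T\<in>F. P T \<epsilon>"
    and mono: "\<And>T \<epsilon> \<epsilon>'. P T \<epsilon> \<Longrightarrow> \<epsilon> \<le> \<epsilon>' \<Longrightarrow> P T \<epsilon>'"
  shows "\<exists>T\<in>F. \<forall>\<epsilon>>0. P T \<epsilon>"
proof (rule ccontr)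
  assume "\<not> ?thesis"
  then obtain e where e: "\<And>T. T \<in> F \<Longrightarrow> 0 < e T \<and> \<not> P T (e T)" by metis
  define \<epsilon> where "\<epsilon> = Min (insert 1 (e ` F))"
  have "0 < \<epsilon>" unfolding \<epsilon>_def using fin e by (subst Min_gr_iff) auto
  then obtain T where "T \<in> F" "P T \<epsilon>" using ex by blast
  moreover have "\<epsilon> \<le> e T" unfolding \<epsilon>_def using fin \<open>T \<in> F\<close> by (intro Min_le) auto
  ultimately show False using e mono by blast
qed

section \<open>A variational bound for the trace of the inverse\<close>

lemma mat_trace_young:
  assumes "dim_row X = dim_row U" "dim_col X = dim_col U" "0 < a"
  shows "2 * mat_trace (transpose_mat X * U) \<le> a * (frobenius_norm X)\<^sup>2 + (frobenius_norm U)\<^sup>2 / a"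
proof -
  have "(\<Sum>i<dim_row U. \<Sum>j<dim_col U. 2 * (X $$ (i, j) * U $$ (i, j)))
      \<le> (\<Sum>i<dim_row U. \<Sum>j<dim_col U. a * (X $$ (i, j))\<^sup>2 + (U $$ (i, j))\<^sup>2 / a)"
    by (intro sum_mono real_young_ineq assms)
  moreover have "mat_trace (transpose_mat X * U) = (\<Sum>i<dim_row U. \<Sum>j<dim_col U. X $$ (i, j) * U $$ (i, j))"
    using assms by (subst sum.swap) (simp add: mat_trace_mult)
  ultimately show ?thesis using assms
    by (simp add: frobenius_norm_square sum.distrib sum_distrib_left sum_divide_distrib)
qed

text \<open>\<open>P\<close> projects onto the row space of the residual \<open>B - A A\<^sup>\<dagger> B\<close>, whose range is orthogonal to that of \<open>A\<close>.\<close>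

lemma pseudoinverse_residual_projection:
  fixes A B :: "real mat"
  assumes A: "A \<in> carrier_mat n l" and B: "B \<in> carrier_mat n m"
  obtains P where "P \<in> carrier_mat m m" "transpose_mat P = P" "P * P = P"
    "mat_trace P \<le> real n - real (vec_space.rank n A)"
    "B = B * P + A * (pseudoinverse A * B * (1\<^sub>m m - P))"
proof -
  define A' where "A' = pseudoinverse A"
  define F where "F = B - A * (A' * B)"
  define F' where "F' = pseudoinverse F"
  note pA = is_pseudoinverse_pseudoinverse[of A, folded A'_def, unfolded is_pseudoinverse_def]
  note pF = is_pseudoinverse_pseudoinverse[of F, folded F'_def, unfolded is_pseudoinverse_def]
  have [simp]: "dim_row A = n" "dim_col A = l" "dim_row B = n" "dim_col B = m"
    "dim_row A' = l" "dim_col A' = n" "dim_row F = n" "dim_col F = m"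
    using A B pA by (auto simp: F_def)
  have [simp]: "dim_row F' = m" "dim_col F' = n" using pF by auto
  define P where "P = F' * F"
  have P: "P \<in> carrier_mat m m" by (simp add: P_def carrier_matI)
  have [simp]: "dim_row P = m" "dim_col P = m" using P by auto
  have Psym: "transpose_mat P = P" using pF by (simp add: P_def)
  have "P * P = (F' * F * F') * F" by (simp add: P_def mat_mult_assoc_dim)
  then have PP: "P * P = P" using pF by (simp add: P_def)
  define R S where "R = A * A'" and "S = F * F'"
  have [simp]: "dim_row R = n" "dim_col R = n" "dim_row S = n" "dim_col S = n"
    by (auto simp: R_def S_def)
  have Rsym: "transpose_mat R = R" and Ssym: "transpose_mat S = S"
    using pA pF by (auto simp: R_def S_def)
  have "R * R = (A * A' * A) * A'" by (simp add: R_def mat_mult_assoc_dim)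
  then have RR: "R * R = R" using pA by (simp add: R_def)
  have "S * S = (F * F' * F) * F'" by (simp add: S_def mat_mult_assoc_dim)
  then have SS: "S * S = S" using pF by (simp add: S_def)
  have FR: "F = B - R * B" by (simp add: F_def R_def mat_mult_assoc_dim)
  have "R * F = R * B - (R * R) * B" by (simp add: FR mat_mult_minus_dim mat_mult_assoc_dim)
  also have "\<dots> = 0\<^sub>m n m" unfolding RR by (intro eq_matI) auto
  finally have RF: "R * F = 0\<^sub>m n m" .
  have RS: "R * S = 0\<^sub>m n n"
  proof -
    have "R * S = (R * F) * F'" by (simp add: S_def mat_mult_assoc_dim)
    then show ?thesis by (simp add: RF)
  qed
  have SR: "S * R = 0\<^sub>m n n"
  proof -
    have "S * R = transpose_mat (R * S)" by (simp add: mat_transpose_mult_dim Rsym Ssym)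
    then show ?thesis by (simp add: RS)
  qed
  \<comment> \<open>\<open>R\<close> and \<open>S\<close> project orthogonally onto the ranges of
    \<open>A\<close> and of the residual \<open>F\<close>. As \<open>R S = 0\<close>, the complement
    of their sum is again a projection, and its nonnegative trace bounds that of \<open>S\<close>,
    which equals that of \<open>P\<close>.\<close>
  have "0 \<le> mat_trace (1\<^sub>m n - (R + S))"
  proof (rule trace_orthogonal_projection_nonneg)
    show "transpose_mat (1\<^sub>m n - (R + S)) = 1\<^sub>m n - (R + S)"
      by (simp add: mat_dim_algebra Rsym Ssym)
    have "(R + S) * (R + S) = R + S"
      by (simp add: mat_mult_add_dim mat_add_mult_dim RR SS RS SR) (intro eq_matI, auto)
    then show "(1\<^sub>m n - (R + S)) * (1\<^sub>m n - (R + S)) = 1\<^sub>m n - (R + S)"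
      by (simp add: mat_mult_minus_dim mat_minus_mult_dim) (intro eq_matI, auto)
  qed
  then have "mat_trace S \<le> real n - mat_trace R" by (simp add: mat_trace_linear)
  moreover have "mat_trace R = real (vec_space.rank n A)"
    unfolding R_def A'_def by (rule mat_trace_mult_pseudoinverse[OF A])
  moreover have "mat_trace P = mat_trace S" unfolding P_def S_def by (rule mat_trace_comm) auto
  ultimately have tr: "mat_trace P \<le> real n - real (vec_space.rank n A)" by simp
  have "F * P = F" using pF by (simp add: P_def mat_mult_assoc_dim)
  then have FP: "B * P - A * (A' * B * P) = B - A * (A' * B)"
    by (simp add: F_def mat_minus_mult_dim mat_mult_assoc_dim)
  have "B = B * P + (A * (A' * B) - A * (A' * B * P))"
  proof (rule eq_matI)
    fix i j assume "i < dim_row (B * P + (A * (A' * B) - A * (A' * B * P)))"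
      "j < dim_col (B * P + (A * (A' * B) - A * (A' * B * P)))"
    then have "i < n" "j < m" by auto
    then show "B $$ (i, j) = (B * P + (A * (A' * B) - A * (A' * B * P))) $$ (i, j)"
      using arg_cong[OF FP, of "\<lambda>M. M $$ (i, j)"] by (simp del: index_mult_mat(1))
  qed auto
  also have "A * (A' * B) - A * (A' * B * P) = A * (A' * B * (1\<^sub>m m - P))"
    by (simp add: mat_mult_minus_dim)
  finally show thesis using that P Psym PP tr by (simp add: A'_def)
qed

text \<open>Each column \<open>b\<close> of \<open>B\<close> satisfies \<open>b \<bullet> L\<^sup>-\<^sup>1 b = min (|u|\<^sup>2 / w + |v|\<^sup>2 / x)\<close> over all
  representations \<open>b = B u + A v\<close>.\<close>

lemma trace_inverse_gram_sum_le:
  fixes A B :: "real mat"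
  assumes A: "A \<in> carrier_mat n l" and B: "B \<in> carrier_mat n m" and w: "0 < w" and x: "0 < x"
    and L: "L = w \<cdot>\<^sub>m (B * transpose_mat B) + x \<cdot>\<^sub>m (A * transpose_mat A)"
    and Li: "Li \<in> carrier_mat n n" "L * Li = 1\<^sub>m n"
    and U: "U \<in> carrier_mat m m" and V: "V \<in> carrier_mat l m" and eq: "B = B * U + A * V"
  shows "mat_trace (transpose_mat B * (Li * B)) \<le> (frobenius_norm U)\<^sup>2 / w + (frobenius_norm V)\<^sup>2 / x"
proof -
  have [simp]: "dim_row A = n" "dim_col A = l" "dim_row B = n" "dim_col B = m" "dim_row Li = n"
    "dim_col Li = n" "dim_row U = m" "dim_col U = m" "dim_row V = l" "dim_col V = m"
    "dim_row L = n" "dim_col L = n"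
    using A B Li U V by (auto simp: L)
  define Z where "Z = Li * B"
  have [simp]: "dim_row Z = n" "dim_col Z = m" by (auto simp: Z_def)
  define X where "X = transpose_mat B * Z"
  define Y where "Y = transpose_mat A * Z"
  have [simp]: "dim_row X = m" "dim_col X = m" "dim_row Y = l" "dim_col Y = m"
    by (auto simp: X_def Y_def)
  have "L * Z = (L * Li) * B" by (simp add: Z_def mat_mult_assoc_dim)
  then have LZ: "L * Z = B" by (simp add: Li)
  have "transpose_mat X = transpose_mat Z * B" by (simp add: X_def mat_dim_algebra)
  then have tr: "mat_trace X = mat_trace (transpose_mat Z * B)" by (metis \<open>dim_row X = m\<close> \<open>dim_col X = m\<close> mat_trace_transpose)
  have "transpose_mat Z * (L * Z) = w \<cdot>\<^sub>m (transpose_mat X * X) + x \<cdot>\<^sub>m (transpose_mat Y * Y)"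
    by (simp add: L X_def Y_def mat_dim_algebra)
  then have 1: "mat_trace X = w * (frobenius_norm X)\<^sup>2 + x * (frobenius_norm Y)\<^sup>2"
    unfolding tr LZ by (simp add: mat_trace_linear frobenius_norm_square_trace')
  have "transpose_mat Z * B = transpose_mat Z * (B * U + A * V)" using eq by simp
  also have "\<dots> = transpose_mat X * U + transpose_mat Y * V"
    by (simp add: X_def Y_def mat_dim_algebra)
  finally have 2: "mat_trace X = mat_trace (transpose_mat X * U) + mat_trace (transpose_mat Y * V)"
    unfolding tr by (simp add: mat_trace_linear)
  \<comment> \<open>By fact \<open>1\<close> the terms in \<open>X\<close> and \<open>Y\<close> add
    up to one \<open>mat_trace X\<close>, which cancels half of the left side. Equality holds for
    \<open>U = w X\<close>, \<open>V = x Y\<close>.\<close>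
  have "2 * mat_trace (transpose_mat X * U) \<le> w * (frobenius_norm X)\<^sup>2 + (frobenius_norm U)\<^sup>2 / w"
    "2 * mat_trace (transpose_mat Y * V) \<le> x * (frobenius_norm Y)\<^sup>2 + (frobenius_norm V)\<^sup>2 / x"
    using w x by (auto intro!: mat_trace_young)
  with 1 2 have "mat_trace X \<le> (frobenius_norm U)\<^sup>2 / w + (frobenius_norm V)\<^sup>2 / x" by linarith
  then show ?thesis by (simp add: X_def Z_def)
qed

lemma mat_smult_mult_vec_dim:
  fixes X :: "real mat"
  shows "dim_col X = dim_vec v \<Longrightarrow> (a \<cdot>\<^sub>m X) *\<^sub>v v = a \<cdot>\<^sub>v (X *\<^sub>v v)"
  by (intro eq_vecI) auto

text \<open>The representation tested is a mixture: weight \<mu> on \<open>U = 1, V = 0\<close> and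
  weight \<open>1 - \<mu>\<close> on \<open>U = P, V = C (1 - P)\<close> from the residual
  projection. Keeping \<mu> free allows it to be optimized against \<open>w\<close>.\<close>

lemma trace_inverse_gram_sum_le_pseudoinverse:
  fixes A B :: "real mat"
  assumes A: "A \<in> carrier_mat n l" and B: "B \<in> carrier_mat n m" and w: "0 < w" and x: "0 < x"
    and L: "L = w \<cdot>\<^sub>m (B * transpose_mat B) + x \<cdot>\<^sub>m (A * transpose_mat A)"
    and Li: "Li \<in> carrier_mat n n" "L * Li = 1\<^sub>m n"
    and \<mu>: "0 \<le> \<mu>" "\<mu> \<le> 1" and N: "N = real n - real (vec_space.rank n A)"
  shows "mat_trace (transpose_mat B * (Li * B))
    \<le> (\<mu>\<^sup>2 * real m + (1 - \<mu>\<^sup>2) * N) / w + (1 - \<mu>)\<^sup>2 * (frobenius_norm (pseudoinverse A * B))\<^sup>2 / x"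
proof -
  define C where "C = pseudoinverse A * B"
  obtain P where P: "P \<in> carrier_mat m m" "transpose_mat P = P" "P * P = P"
    "mat_trace P \<le> N" "B = B * P + A * (C * (1\<^sub>m m - P))"
    unfolding N C_def by (rule pseudoinverse_residual_projection[OF A B])
  have C: "C \<in> carrier_mat l m"
    using is_pseudoinverse_pseudoinverse[of A] A B by (auto simp: C_def is_pseudoinverse_def)
  have [simp]: "dim_row A = n" "dim_col A = l" "dim_row B = n" "dim_col B = m"
    "dim_row P = m" "dim_col P = m" "dim_row C = l" "dim_col C = m" using A B P C by auto
  define D where "D = 1\<^sub>m m - P"
  have [simp]: "dim_row D = m" "dim_col D = m" by (auto simp: D_def)
  have Dsym: "transpose_mat D = D" by (simp add: D_def mat_dim_algebra P(2))
  have DD: "D * D = D"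
    by (simp add: D_def mat_mult_minus_dim mat_minus_mult_dim P(3)) (intro eq_matI, auto)
  define U V where "U = \<mu> \<cdot>\<^sub>m 1\<^sub>m m + (1 - \<mu>) \<cdot>\<^sub>m P" and "V = (1 - \<mu>) \<cdot>\<^sub>m (C * D)"
  have UV: "U \<in> carrier_mat m m" "V \<in> carrier_mat l m"
    by (auto simp: U_def V_def intro!: carrier_matI)
  have "B * U + A * V = \<mu> \<cdot>\<^sub>m B + (1 - \<mu>) \<cdot>\<^sub>m (B * P) + (1 - \<mu>) \<cdot>\<^sub>m (A * (C * D))"
    by (simp add: U_def V_def mat_mult_add_dim mat_mult_smult_dim)
  also have "\<dots> = \<mu> \<cdot>\<^sub>m B + (1 - \<mu>) \<cdot>\<^sub>m (B * P + A * (C * D))"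
    by (intro eq_matI) (auto simp: algebra_simps)
  also have "\<dots> = B" unfolding D_def P(5)[symmetric] by (intro eq_matI) (auto simp: algebra_simps)
  finally have eq: "B = B * U + A * V" by simp
  \<comment> \<open>Since \<open>P\<close> is idempotent, the coefficients of \<open>P\<close>
    collect to \<open>2 \<mu> (1 - \<mu>) + (1 - \<mu>)\<^sup>2 = 1 - \<mu>\<^sup>2\<close>.\<close>
  have "U * transpose_mat U = \<mu>\<^sup>2 \<cdot>\<^sub>m 1\<^sub>m m + (1 - \<mu>\<^sup>2) \<cdot>\<^sub>m P"
    by (simp add: U_def mat_dim_algebra P(2,3))
      (intro eq_matI, auto simp: algebra_simps power2_eq_square)
  then have fU: "(frobenius_norm U)\<^sup>2 = \<mu>\<^sup>2 * real m + (1 - \<mu>\<^sup>2) * mat_trace P"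
    by (simp add: frobenius_norm_square_trace mat_trace_linear)
  have "(frobenius_norm (C * D))\<^sup>2 = mat_trace (C * ((D * D) * transpose_mat C))"
    by (simp add: frobenius_norm_square_trace mat_dim_algebra Dsym)
  also have "\<dots> = mat_trace (C * transpose_mat C) - mat_trace (C * (P * transpose_mat C))"
    unfolding DD unfolding D_def
    by (simp add: mat_mult_minus_dim mat_minus_mult_dim mat_trace_linear)
  also have "mat_trace (C * (P * transpose_mat C)) = (frobenius_norm (C * P))\<^sup>2"
  proof -
    have "(frobenius_norm (C * P))\<^sup>2 = mat_trace (C * ((P * P) * transpose_mat C))"
      by (simp add: frobenius_norm_square_trace mat_dim_algebra P(2))
    then show ?thesis by (simp add: P(3))
  qed
  finally have "(frobenius_norm (C * D))\<^sup>2 \<le> (frobenius_norm C)\<^sup>2"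
    by (simp add: frobenius_norm_square_trace[of C])
  moreover have "(frobenius_norm V)\<^sup>2 = (1 - \<mu>)\<^sup>2 * (frobenius_norm (C * D))\<^sup>2"
    by (simp add: V_def frobenius_norm_square power_mult_distrib sum_distrib_left del: index_mult_mat(1))
  ultimately have fV: "(frobenius_norm V)\<^sup>2 \<le> (1 - \<mu>)\<^sup>2 * (frobenius_norm C)\<^sup>2"
    by (simp add: mult_left_mono)
  have "\<mu>\<^sup>2 \<le> 1" using \<mu> by (simp add: power_le_one)
  then have "(frobenius_norm U)\<^sup>2 \<le> \<mu>\<^sup>2 * real m + (1 - \<mu>\<^sup>2) * N"
    unfolding fU using P(4) by (intro add_left_mono mult_left_mono) auto
  then have "(frobenius_norm U)\<^sup>2 / w + (frobenius_norm V)\<^sup>2 / x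
      \<le> (\<mu>\<^sup>2 * real m + (1 - \<mu>\<^sup>2) * N) / w + (1 - \<mu>)\<^sup>2 * (frobenius_norm C)\<^sup>2 / x"
    using w x fV by (intro add_mono divide_right_mono) auto
  with trace_inverse_gram_sum_le[OF A B w x L Li UV eq] show ?thesis by (simp add: C_def)
qed

text \<open>This \<open>\<mu>\<close> minimizes \<open>\<mu>\<^sup>2 / w + (1 - \<mu>)\<^sup>2 \<tau> / (1 + w)\<close>.\<close>

lemma potential_value:
  fixes N d \<tau> w :: real
  assumes w: "0 < w" and \<tau>: "0 \<le> \<tau>" and \<mu>: "\<mu> = w * \<tau> / (1 + w + w * \<tau>)"
  shows "1 / (1 + w) * (N + d + (\<mu>\<^sup>2 * (N + d) + (1 - \<mu>\<^sup>2) * N) / w + (1 - \<mu>)\<^sup>2 * (\<tau> * d) / (1 + w))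
    = N / w + d / (w + 1 / (1 + \<tau>))"
proof -
  define y where "y = 1 + w + w * \<tau>"
  have y: "0 < y" using w \<tau> by (simp add: y_def add_pos_nonneg)
  have l: "\<mu> = w * \<tau> / y" "1 - \<mu> = (1 + w) / y" using y by (auto simp: \<mu> y_def field_simps)
  have 1: "\<mu>\<^sup>2 / w + (1 - \<mu>)\<^sup>2 * \<tau> / (1 + w) = \<tau> / y"
  proof -
    have "\<mu>\<^sup>2 / w + (1 - \<mu>)\<^sup>2 * \<tau> / (1 + w) = (w * \<tau>\<^sup>2 + (1 + w) * \<tau>) / y\<^sup>2"
      unfolding l(2) unfolding l(1) using w y
      by (simp add: divide_simps) (simp add: power2_eq_square algebra_simps)
    also have "w * \<tau>\<^sup>2 + (1 + w) * \<tau> = \<tau> * y" by (simp add: y_def power2_eq_square algebra_simps)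
    finally show ?thesis using y by (simp add: power2_eq_square)
  qed
  have "N + d + (\<mu>\<^sup>2 * (N + d) + (1 - \<mu>\<^sup>2) * N) / w + (1 - \<mu>)\<^sup>2 * (\<tau> * d) / (1 + w)
      = N * ((1 + w) / w) + d * (1 + (\<mu>\<^sup>2 / w + (1 - \<mu>)\<^sup>2 * \<tau> / (1 + w)))"
    using w by (simp add: divide_simps) (simp add: algebra_simps)
  also have "\<dots> = N * ((1 + w) / w) + d * ((1 + w) * (1 + \<tau>) / y)"
    unfolding 1 using y by (simp add: field_simps) (simp add: y_def algebra_simps)
  also have "\<dots> = (1 + w) * (N / w + d * ((1 + \<tau>) / y))"
    by (simp add: algebra_simps)
  finally have "1 / (1 + w) * (N + d + (\<mu>\<^sup>2 * (N + d) + (1 - \<mu>\<^sup>2) * N) / w + (1 - \<mu>)\<^sup>2 * (\<tau> * d) / (1 + w))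
      = N / w + d * ((1 + \<tau>) / y)" using w by simp
  also have "(1 + \<tau>) / y = 1 / (w + 1 / (1 + \<tau>))"
  proof -
    have "w + 1 / (1 + \<tau>) = y / (1 + \<tau>)" using \<tau> by (simp add: y_def field_simps)
    then show ?thesis by simp
  qed
  finally show ?thesis by simp
qed

text \<open>With \<open>L = x M - B B\<^sup>T\<close>, Woodbury gives \<open>(x - G)\<^sup>-\<^sup>1
  = (1 + B\<^sup>T L\<^sup>-\<^sup>1 B) / x\<close>. As \<open>x - 1 = w\<close>, this
  \<open>L\<close> is a positive combination of \<open>A A\<^sup>T\<close> and
  \<open>B B\<^sup>T\<close>, and it is invertible because \<open>[A B]\<close> has full row
  rank.\<close>

lemma woodbury_initial_inverse:
  fixes A B :: "real mat"
  assumes A: "A \<in> carrier_mat n l" and B: "B \<in> carrier_mat n m" and w: "0 < w"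
    and rC: "vec_space.rank n (hconcat A B) = n"
    and Mi: "Mi \<in> carrier_mat n n" "Mi * (A * transpose_mat A + B * transpose_mat B) = 1\<^sub>m n"
    and G: "G = transpose_mat B * (Mi * B)"
    and N: "N = real n - real (vec_space.rank n A)" "N < real m"
    and h: "h = 1 / (1 + (frobenius_norm (pseudoinverse A * B))\<^sup>2 / (real m - N))"
  shows "\<exists>K. sym_inverse_on {0..<m} (shift (\<lambda>i j. - G $$ (i, j)) (- (1 + w))) K \<and>
    (\<Sum>i\<in>{0..<m}. K i i) \<le> N / w + (real m - N) / (w + h)"
proof -
  define x where "x = 1 + w"
  have x: "0 < x" using w by (simp add: x_def)
  define M where "M = A * transpose_mat A + B * transpose_mat B"
  define L where "L = w \<cdot>\<^sub>m (B * transpose_mat B) + x \<cdot>\<^sub>m (A * transpose_mat A)"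
  have [simp]: "dim_row A = n" "dim_col A = l" "dim_row B = n" "dim_col B = m"
    "dim_row M = n" "dim_col M = n" "dim_row L = n" "dim_col L = n" "dim_row Mi = n" "dim_col Mi = n"
    using A B Mi by (auto simp: M_def L_def)
  have Lc: "L \<in> carrier_mat n n" by (simp add: carrier_matI)
  have Lsym: "transpose_mat L = L" by (simp add: L_def mat_dim_algebra)
  have Linj: "v = 0\<^sub>v n" if v: "v \<in> carrier_vec n" and 0: "L *\<^sub>v v = 0\<^sub>v n" for v
  proof -
    have [simp]: "dim_vec v = n" using v by simp
    have "v \<bullet> (L *\<^sub>v v) = w * (v \<bullet> ((B * transpose_mat B) *\<^sub>v v)) + x * (v \<bullet> ((A * transpose_mat A) *\<^sub>v v))"
      unfolding L_def using A B v
      by (subst add_mult_distrib_mat_vec[of _ n n])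
        (auto simp: scalar_prod_add_distrib[of _ n] mat_smult_mult_vec_dim)
    also have "\<dots> = w * ((transpose_mat B *\<^sub>v v) \<bullet> (transpose_mat B *\<^sub>v v)) + x * ((transpose_mat A *\<^sub>v v) \<bullet> (transpose_mat A *\<^sub>v v))"
      by (simp only: gram_quadratic_form[OF A v v] gram_quadratic_form[OF B v v])
    finally have "w * ((transpose_mat B *\<^sub>v v) \<bullet> (transpose_mat B *\<^sub>v v)) + x * ((transpose_mat A *\<^sub>v v) \<bullet> (transpose_mat A *\<^sub>v v)) = 0"
      using v by (simp add: 0)
    then have "(transpose_mat B *\<^sub>v v) \<bullet> (transpose_mat B *\<^sub>v v) = 0" "(transpose_mat A *\<^sub>v v) \<bullet> (transpose_mat A *\<^sub>v v) = 0"
      using w x real_scalar_prod_self(1)[of "transpose_mat B *\<^sub>v v"] real_scalar_prod_self(1)[of "transpose_mat A *\<^sub>v v"]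
      by (auto simp: add_nonneg_eq_0_iff)
    then have "(transpose_mat (hconcat A B) *\<^sub>v v) \<bullet> (transpose_mat (hconcat A B) *\<^sub>v v) = 0"
      by (simp add: hconcat_transpose_mult_norm[OF A B v])
    then have "transpose_mat (hconcat A B) *\<^sub>v v = 0\<^sub>v (l + m)"
      using real_scalar_prod_self(2) hconcat_carrier[OF A B] by fastforce
    then show ?thesis using rC v rank_eq_dim_row_iff[OF hconcat_carrier[OF A B]] by blast
  qed
  obtain Li where Li: "Li \<in> carrier_mat n n" "L * Li = 1\<^sub>m n" "Li * L = 1\<^sub>m n" "transpose_mat Li = Li"
    by (rule injective_square_mat_inverse[OF Lc Lsym Linj])
  have [simp]: "dim_row Li = n" "dim_col Li = n" using Li by auto
  define Y where "Y = Li * B"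
  define R where "R = transpose_mat B * Y"
  have [simp]: "dim_row Y = n" "dim_col Y = m" "dim_row R = m" "dim_col R = m" "dim_row G = m" "dim_col G = m"
    by (auto simp: Y_def R_def G)
  have "L * Y = (L * Li) * B" by (simp add: Y_def mat_mult_assoc_dim)
  then have LY: "L * Y = B" by (simp add: Li)
  have "Mi * (M * Y) = (Mi * M) * Y" by (simp add: mat_mult_assoc_dim)
  then have MY: "Mi * (M * Y) = Y" using Mi(2) by (simp add: M_def[symmetric])
  have "B * transpose_mat B = x \<cdot>\<^sub>m M - L"
    by (intro eq_matI) (auto simp: M_def L_def x_def algebra_simps)
  then have "(B * transpose_mat B) * Y = x \<cdot>\<^sub>m (M * Y) - B"
    by (simp add: mat_minus_mult_dim mat_smult_mult_dim LY)
  then have BY: "B * (transpose_mat B * Y) = x \<cdot>\<^sub>m (M * Y) - B" by (simp add: mat_mult_assoc_dim)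
  have "G * R = transpose_mat B * (Mi * (B * (transpose_mat B * Y)))"
    by (simp add: G R_def mat_mult_assoc_dim)
  also have "\<dots> = x \<cdot>\<^sub>m R - G"
    unfolding BY by (simp add: mat_mult_minus_dim mat_mult_smult_dim MY R_def G)
  finally have GR: "G * R = x \<cdot>\<^sub>m R - G" .
  define K where "K = (1 / x) \<cdot>\<^sub>m (1\<^sub>m m + R)"
  have [simp]: "dim_row K = m" "dim_col K = m" by (auto simp: K_def)
  have "transpose_mat R = R" by (simp add: R_def Y_def mat_dim_algebra Li(4))
  then have Ksym: "transpose_mat K = K" by (simp add: K_def mat_dim_algebra)
  have "(x \<cdot>\<^sub>m 1\<^sub>m m - G) * K = (1 / x) \<cdot>\<^sub>m (x \<cdot>\<^sub>m 1\<^sub>m m + x \<cdot>\<^sub>m R - (G + G * R))"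
    by (simp add: K_def mat_mult_smult_dim mat_mult_add_dim mat_minus_mult_dim mat_smult_mult_dim)
      (intro eq_matI, auto simp del: index_mult_mat(1) simp: algebra_simps)
  also have "\<dots> = 1\<^sub>m m" unfolding GR using x by (intro eq_matI) auto
  finally have inv: "(x \<cdot>\<^sub>m 1\<^sub>m m - G) * K = 1\<^sub>m m" .
  have "sym_inverse_on {0..<m} (shift (\<lambda>i j. - G $$ (i, j)) (- x)) (\<lambda>i j. K $$ (i, j))"
    unfolding sym_inverse_on_def
  proof (intro conjI ballI)
    fix i j assume "i \<in> {0..<m}" "j \<in> {0..<m}"
    then show "K $$ (i, j) = K $$ (j, i)" using arg_cong[OF Ksym, of "\<lambda>X. X $$ (i, j)"] by simp
  next
    fix i j assume ij: "i \<in> {0..<m}" "j \<in> {0..<m}"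
    have "(\<Sum>l\<in>{0..<m}. (- G $$ (i, l) - - x * of_bool (i = l)) * K $$ (l, j)) = ((x \<cdot>\<^sub>m 1\<^sub>m m - G) * K) $$ (i, j)"
      using ij by (auto simp: scalar_prod_def intro!: sum.cong)
    then show "(\<Sum>l\<in>{0..<m}. (- G $$ (i, l) - - x * of_bool (i = l)) * K $$ (l, j)) = of_bool (i = j)"
      using ij by (simp add: inv)
  qed
  moreover have "(\<Sum>i\<in>{0..<m}. K $$ (i, i)) \<le> N / w + (real m - N) / (w + h)"
  proof -
    define d \<tau> where "d = real m - N" and "\<tau> = (frobenius_norm (pseudoinverse A * B))\<^sup>2 / d"
    define \<mu> where "\<mu> = w * \<tau> / (1 + w + w * \<tau>)"
    have d: "0 < d" using N(2) by (simp add: d_def)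
    have \<tau>: "0 \<le> \<tau>" using d by (simp add: \<tau>_def)
    have "0 \<le> w * \<tau>" using w \<tau> by simp
    then have \<mu>: "0 \<le> \<mu>" "\<mu> \<le> 1" using w by (auto simp: \<mu>_def divide_le_eq)
    have t: "(frobenius_norm (pseudoinverse A * B))\<^sup>2 = \<tau> * d" using d by (simp add: \<tau>_def)
    have m: "real m = N + d" by (simp add: d_def)
    have "(\<Sum>i\<in>{0..<m}. K $$ (i, i)) = mat_trace K" by (simp add: mat_trace_def atLeast0LessThan)
    also have "\<dots> = 1 / x * (real m + mat_trace R)" by (simp add: K_def mat_trace_linear)
    also have "\<dots> \<le> 1 / x * (real m + ((\<mu>\<^sup>2 * real m + (1 - \<mu>\<^sup>2) * N) / w + (1 - \<mu>)\<^sup>2 * (\<tau> * d) / x))"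
      using trace_inverse_gram_sum_le_pseudoinverse[OF A B w x L_def Li(1,2) \<mu> N(1)] x
      unfolding R_def Y_def t by (intro mult_left_mono add_left_mono) auto
    also have "\<dots> = N / w + d / (w + 1 / (1 + \<tau>))"
      unfolding m x_def using potential_value[OF w \<tau> \<mu>_def, of N d] by (simp only: add.assoc)
    finally show ?thesis by (simp add: d_def \<tau>_def h)
  qed
  ultimately show ?thesis unfolding x_def by (intro exI[of _ "\<lambda>i j. K $$ (i, j)"]) blast
qed

subsection \<open>From principal submatrices to column subsets\<close>

text \<open>\<open>G\<close> is the Gram matrix of the columns of \<open>B\<close> whitened by
  \<open>M\<^sup>-\<^sup>1\<^sup>/\<^sup>2\<close>, where \<open>M = C C\<^sup>T\<close>. The vector
  \<open>C\<^sup>T z\<close> stands in for the whitened \<open>B u\<close>, so no matrix square root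
  is taken.\<close>

lemma whitened_gram_form:
  fixes C B :: "real mat"
  assumes C: "C \<in> carrier_mat n q" and B: "B \<in> carrier_mat n m"
    and Mi: "Mi \<in> carrier_mat n n" "(C * transpose_mat C) * Mi = 1\<^sub>m n"
    and G: "G = transpose_mat B * (Mi * B)" and u: "u \<in> carrier_vec m"
    and z: "z = Mi *\<^sub>v (B *\<^sub>v u)"
  shows "z \<in> carrier_vec n"
    and "y \<in> carrier_vec n \<Longrightarrow> (transpose_mat C *\<^sub>v y) \<bullet> (transpose_mat C *\<^sub>v z) = (transpose_mat B *\<^sub>v y) \<bullet> u"
    and "u \<bullet> (G *\<^sub>v u) = (transpose_mat C *\<^sub>v z) \<bullet> (transpose_mat C *\<^sub>v z)"
proof -
  have [simp]: "dim_row B = n" "dim_col B = m" "dim_row C = n" "dim_row Mi = n" "dim_col Mi = n" "dim_vec u = m"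
    using B C Mi u by auto
  have Bu: "B *\<^sub>v u \<in> carrier_vec n" using B by (simp add: carrier_vecI)
  show zn: "z \<in> carrier_vec n" by (simp add: z carrier_vecI)
  have "(C * transpose_mat C) *\<^sub>v z = (C * transpose_mat C * Mi) *\<^sub>v (B *\<^sub>v u)"
    unfolding z by (rule assoc_mult_mat_vec[symmetric, OF _ Mi(1) Bu]) (use C in auto)
  then have Mz: "(C * transpose_mat C) *\<^sub>v z = B *\<^sub>v u" using Bu by (simp add: Mi(2))
  show pairing: "(transpose_mat C *\<^sub>v y) \<bullet> (transpose_mat C *\<^sub>v z) = (transpose_mat B *\<^sub>v y) \<bullet> u"
    if y: "y \<in> carrier_vec n" for y
  proof -
    have "(transpose_mat C *\<^sub>v y) \<bullet> (transpose_mat C *\<^sub>v z) = y \<bullet> ((C * transpose_mat C) *\<^sub>v z)"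
      by (rule gram_quadratic_form[OF C y zn, symmetric])
    also have "\<dots> = (transpose_mat B *\<^sub>v y) \<bullet> u"
      unfolding Mz using y by (intro scalar_prod_mult_mat_vec_dim) auto
    finally show ?thesis .
  qed
  have "G *\<^sub>v u = transpose_mat B *\<^sub>v z" by (simp add: G z mat_mult_vec_assoc_dim)
  then have "u \<bullet> (G *\<^sub>v u) = (transpose_mat B *\<^sub>v z) \<bullet> u"
    using comm_scalar_prod[OF u, of "transpose_mat B *\<^sub>v z"] by (simp add: carrier_vecI)
  then show "u \<bullet> (G *\<^sub>v u) = (transpose_mat C *\<^sub>v z) \<bullet> (transpose_mat C *\<^sub>v z)"
    using pairing[OF zn] by simp
qed

text \<open>The barrier matrix \<open>x - G\<close> is written as \<open>shift\<close> of
  \<open>- G\<close> by \<open>- x\<close>, so that lowering \<open>x\<close> is just a further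
  shift; this lemma evaluates its \<open>- G\<close> part.\<close>

lemma quad_on_uminus_mat:
  assumes G: "G \<in> carrier_mat m m" and T: "T \<subseteq> {0..<m}"
    and u: "u = vec m (\<lambda>j. if j \<in> T then f j else 0)"
  shows "quad_on T (\<lambda>i j. - G $$ (i, j)) f = - (u \<bullet> (G *\<^sub>v u))"
proof -
  have "u \<bullet> (G *\<^sub>v u) = (\<Sum>i\<in>{0..<m}. u $ i * (\<Sum>j\<in>{0..<m}. G $$ (i, j) * u $ j))"
    using G by (auto simp: scalar_prod_def u intro!: sum.cong)
  also have "\<dots> = (\<Sum>i\<in>T. f i * (\<Sum>j\<in>{0..<m}. G $$ (i, j) * u $ j))"
    using T by (intro sum.mono_neutral_cong_right) (auto simp: u)
  also have "\<dots> = (\<Sum>i\<in>T. f i * (\<Sum>j\<in>T. G $$ (i, j) * f j))"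
  proof -
    have "(\<Sum>j\<in>{0..<m}. G $$ (i, j) * u $ j) = (\<Sum>j\<in>T. G $$ (i, j) * f j)" for i
      using T by (intro sum.mono_neutral_cong_right) (auto simp: u)
    then show ?thesis by simp
  qed
  finally show ?thesis by (simp add: quad_on_alt sum_negf)
qed

text \<open>\<open>G\<close> is at most 1 because \<open>B B\<^sup>T\<close> is at most
  \<open>M\<close>: Young's inequality bounds twice \<open>u \<bullet> (G u)\<close> by the squared
  norms of \<open>B\<^sup>T z\<close> and \<open>u\<close>, and the former is at most
  \<open>u \<bullet> (G u)\<close> itself.\<close>

lemma whitened_gram_pos_def:
  fixes A B :: "real mat"
  assumes A: "A \<in> carrier_mat n l" and B: "B \<in> carrier_mat n m"
    and Mi: "Mi \<in> carrier_mat n n" "(hconcat A B * transpose_mat (hconcat A B)) * Mi = 1\<^sub>m n"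
      "transpose_mat Mi = Mi"
    and G: "G = transpose_mat B * (Mi * B)" and x: "1 < x"
  shows "pos_def_on {0..<m} (shift (\<lambda>i j. - G $$ (i, j)) (- x))"
  unfolding pos_def_on_def
proof (intro conjI ballI allI impI)
  have [simp]: "dim_row B = n" "dim_col B = m" "dim_row Mi = n" "dim_col Mi = n" using B Mi by auto
  have Gc: "G \<in> carrier_mat m m" by (auto simp: G)
  fix i j assume ij: "i \<in> {0..<m}" "j \<in> {0..<m}"
  have "transpose_mat G = G" by (simp add: G mat_dim_algebra Mi(3))
  then have "G $$ (i, j) = G $$ (j, i)" using ij Gc by (metis atLeastLessThan_iff carrier_matD index_transpose_mat(1))
  then show "- G $$ (i, j) - - x * of_bool (i = j) = - G $$ (j, i) - - x * of_bool (j = i)" by auto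
next
  have [simp]: "dim_row B = n" "dim_col B = m" "dim_row Mi = n" "dim_col Mi = n" using B Mi by auto
  have Gc: "G \<in> carrier_mat m m" by (auto simp: G)
  fix v :: "nat \<Rightarrow> real" assume v: "\<exists>i\<in>{0..<m}. v i \<noteq> 0"
  define u where "u = vec m (\<lambda>j. if j \<in> {0..<m} then v j else 0)"
  have u: "u \<in> carrier_vec m" by (simp add: u_def)
  define z where "z = Mi *\<^sub>v (B *\<^sub>v u)"
  note W = whitened_gram_form[OF hconcat_carrier[OF A B] B Mi(1,2) G u z_def]
  let ?C = "transpose_mat (hconcat A B) *\<^sub>v z" and ?B = "transpose_mat B *\<^sub>v z"
  have "2 * (?C \<bullet> ?C) = 2 * (?B \<bullet> u)" using W(2)[OF W(1)] by simp
  also have "\<dots> \<le> 1 * (?B \<bullet> ?B) + (u \<bullet> u) / 1" using u by (intro real_scalar_prod_young) auto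
  also have "?B \<bullet> ?B \<le> ?C \<bullet> ?C"
    unfolding hconcat_transpose_mult_norm[OF A B W(1)] using real_scalar_prod_self(1) by simp
  finally have le: "u \<bullet> (G *\<^sub>v u) \<le> u \<bullet> u" using W(3) by simp
  have uu: "u \<bullet> u = (\<Sum>i\<in>{0..<m}. (v i)\<^sup>2)" by (simp add: scalar_prod_def u_def power2_eq_square)
  have pos: "0 < (\<Sum>i\<in>{0..<m}. (v i)\<^sup>2)" using v by (auto intro: sum_pos2)
  then have "(\<Sum>i\<in>{0..<m}. (v i)\<^sup>2) < x * (\<Sum>i\<in>{0..<m}. (v i)\<^sup>2)" using x by simp
  then show "0 < quad_on {0..<m} (shift (\<lambda>i j. - G $$ (i, j)) (- x)) v"
    unfolding quad_on_shift[OF finite_atLeastLessThan] quad_on_uminus_mat[OF Gc subset_refl u_def]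
    using le uu by simp
qed

text \<open>Passes from \<open>B\<^sub>T\<^sup>T M\<^sup>-\<^sup>1 B\<^sub>T \<le> a\<close> to
  \<open>B\<^sub>T B\<^sub>T\<^sup>T \<le> a M\<close>. The form is tested on
  \<open>B\<^sup>T y\<close> cut down to \<open>T\<close>; Young's inequality with weight
  \<open>a\<close> then absorbs half of the doubled sum.\<close>

lemma restricted_column_norm_le:
  fixes C B :: "real mat"
  assumes C: "C \<in> carrier_mat n q" and B: "B \<in> carrier_mat n m"
    and Mi: "Mi \<in> carrier_mat n n" "(C * transpose_mat C) * Mi = 1\<^sub>m n"
    and G: "G = transpose_mat B * (Mi * B)" and T: "T \<subseteq> {0..<m}" "T \<noteq> {}"
    and pd: "pos_def_on T (shift (\<lambda>i j. - G $$ (i, j)) (- a))" and y: "y \<in> carrier_vec n"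
  shows "(\<Sum>j\<in>T. ((transpose_mat B *\<^sub>v y) $ j)\<^sup>2) \<le> a * ((transpose_mat C *\<^sub>v y) \<bullet> (transpose_mat C *\<^sub>v y))"
proof -
  have Gc: "G \<in> carrier_mat m m" using B Mi by (auto simp: G)
  have fin: "finite T" using T finite_subset by blast
  have form: "u \<bullet> (G *\<^sub>v u) \<le> a * (\<Sum>j\<in>T. (f j)\<^sup>2)"
    if "u = vec m (\<lambda>j. if j \<in> T then f j else 0)" for u f
    using pos_def_on_nonneg[OF pd, of f]
    unfolding quad_on_shift[OF fin] quad_on_uminus_mat[OF Gc T(1) that] by simp
  \<comment> \<open>Young's inequality needs a positive weight. Testing the form at a unit vector in
    \<open>T\<close> shows that \<open>a\<close> exceeds a diagonal entry of \<open>G\<close>, which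
    is nonnegative.\<close>
  have a: "0 < a"
  proof -
    obtain t where t: "t \<in> T" using T by blast
    define u where "u = vec m (\<lambda>j. if j \<in> T then of_bool (j = t) else 0 :: real)"
    have u: "u \<in> carrier_vec m" by (simp add: u_def)
    have "0 \<le> u \<bullet> (G *\<^sub>v u)"
      unfolding whitened_gram_form(3)[OF C B Mi G u refl] by (rule real_scalar_prod_self)
    moreover have "0 < quad_on T (shift (\<lambda>i j. - G $$ (i, j)) (- a)) (\<lambda>j. of_bool (j = t))"
      using pd t unfolding pos_def_on_def by auto
    moreover have "(\<Sum>j\<in>T. (of_bool (j = t) :: real)\<^sup>2) = 1"
      using sum_of_bool_mult(1)[OF fin t, of "\<lambda>j. of_bool (j = t)"] by (simp add: power2_eq_square)
    ultimately show ?thesis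
      unfolding quad_on_shift[OF fin] quad_on_uminus_mat[OF Gc T(1) u_def] by simp
  qed
  define f where "f j = (transpose_mat B *\<^sub>v y) $ j" for j
  define u where "u = vec m (\<lambda>j. if j \<in> T then f j else 0)"
  have u: "u \<in> carrier_vec m" by (simp add: u_def)
  define z where "z = Mi *\<^sub>v (B *\<^sub>v u)"
  note W = whitened_gram_form[OF C B Mi G u z_def]
  let ?y = "transpose_mat C *\<^sub>v y" and ?z = "transpose_mat C *\<^sub>v z"
  have s: "(transpose_mat B *\<^sub>v y) \<bullet> u = (\<Sum>j\<in>T. (f j)\<^sup>2)"
  proof -
    have "(transpose_mat B *\<^sub>v y) \<bullet> u = (\<Sum>j\<in>{0..<m}. f j * u $ j)"
      by (simp add: scalar_prod_def f_def u_def)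
    also have "\<dots> = (\<Sum>j\<in>T. (f j)\<^sup>2)"
      using T(1) by (intro sum.mono_neutral_cong_right) (auto simp: u_def power2_eq_square)
    finally show ?thesis .
  qed
  have "2 * (\<Sum>j\<in>T. (f j)\<^sup>2) = 2 * (?y \<bullet> ?z)" using W(2)[OF y] s by simp
  also have "\<dots> \<le> a * (?y \<bullet> ?y) + (?z \<bullet> ?z) / a" using a by (intro real_scalar_prod_young) auto
  also have "(?z \<bullet> ?z) / a \<le> (\<Sum>j\<in>T. (f j)\<^sup>2)"
    using form[OF u_def] a unfolding W(3) by (simp add: divide_le_eq mult.commute)
  finally show ?thesis by (simp add: f_def)
qed

theorem theorem1p3:
  fixes A B :: "real mat" and n l m r k :: nat
  assumes "A \<in> carrier_mat n l"
    and "B \<in> carrier_mat n m"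
    and "vec_space.rank n A = r"
    and "vec_space.rank n (hconcat A B) = n"
    and "int n - int r \<le> int k"
    and "int k \<le> int m - 1"
  shows "\<exists>S\<^sub>0 \<subseteq> {0..<m}. card S\<^sub>0 = k \<and>
    vec_space.rank n (hconcat A (col_submatrix B S\<^sub>0)) = n \<and>
    (\<forall>mat_norm \<in> {spectral_norm, frobenius_norm}.
      (mat_norm (pseudoinverse (hconcat A (col_submatrix B S\<^sub>0))))\<^sup>2
        \<le> Gamma_bound m n k r
           * (1 + (frobenius_norm (pseudoinverse A * B))\<^sup>2 / (real m - real n + real r))
           * (mat_norm (pseudoinverse (hconcat A B)))\<^sup>2)"
proof -
  note A = assms(1) and B = assms(2) and r = assms(3) and rC = assms(4)
  define C where "C = hconcat A B"
  have C: "C \<in> carrier_mat n (l + m)" unfolding C_def by (rule hconcat_carrier[OF A B])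
  define N K where "N = real n - real r" and "K = real k + 1"
  \<comment> \<open>The trace of this projection lies between 0 and \<open>N\<close>, which gives
    \<open>r \<le> n\<close>.\<close>
  obtain P :: "real mat" where "transpose_mat P = P" "P * P = P" "mat_trace P \<le> N"
    using pseudoinverse_residual_projection[OF A B] r by (metis N_def)
  then have N0: "0 \<le> N" using trace_orthogonal_projection_nonneg[of P] by simp
  have NK: "N < K" and Km: "K \<le> real m" and km: "k < m"
    using assms(5,6) by (auto simp: N_def K_def)
  have Nm: "N < real m" using NK Km by simp
  define \<tau> where "\<tau> = (frobenius_norm (pseudoinverse A * B))\<^sup>2 / (real m - N)"
  define h where "h = 1 / (1 + \<tau>)"
  have \<tau>: "0 \<le> \<tau>" using Nm by (simp add: \<tau>_def)
  have h: "0 < h" using \<tau> by (simp add: h_def add_pos_nonneg)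
  \<comment> \<open>The reciprocal of \<open>Gamma_bound m n k r * (1 + \<tau>)\<close>.\<close>
  define c where "c = h * (sqrt (K * (real m - N)) - sqrt (N * (real m - K)))\<^sup>2 / (real m)\<^sup>2"
  \<comment> \<open>\<open>N < K\<close> separates the two square roots, so the denominator of
    \<open>Gamma_bound\<close> is nonzero and the bound is not the default value of a division by
    zero.\<close>
  have c: "0 < c"
  proof -
    have "N * real m < K * real m" using NK km by simp
    then have "N * (real m - K) < K * (real m - N)" by (simp add: algebra_simps)
    then have "sqrt (N * (real m - K)) < sqrt (K * (real m - N))" by simp
    then show ?thesis using h km by (simp add: c_def)
  qed
  obtain Mi where Mi: "Mi \<in> carrier_mat n n" "(C * transpose_mat C) * Mi = 1\<^sub>m n"
    "Mi * (C * transpose_mat C) = 1\<^sub>m n" "transpose_mat Mi = Mi"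
    by (rule gram_inverse_of_full_row_rank[OF C rC[folded C_def]])
  define G where "G = transpose_mat B * (Mi * B)"
  \<comment> \<open>In the Loewner order: \<open>B\<^sub>T B\<^sub>T\<^sup>T \<le> (1 - c +
    \<epsilon>) C C\<^sup>T\<close>.\<close>
  define good where "good T \<epsilon> \<longleftrightarrow> (\<forall>y\<in>carrier_vec n. (\<Sum>j\<in>T. ((transpose_mat B *\<^sub>v y) $ j)\<^sup>2)
      \<le> (1 - c + \<epsilon>) * ((transpose_mat C *\<^sub>v y) \<bullet> (transpose_mat C *\<^sub>v y)))" for T \<epsilon>
  have "\<exists>T\<in>{T. T \<subseteq> {0..<m} \<and> card T = m - k}. \<forall>\<epsilon>>0. good T \<epsilon>"
  proof (rule finite_family_uniform_limit)
    show "finite {T. T \<subseteq> {0..<m} \<and> card T = m - k}"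
      by (rule finite_subset[of _ "Pow {0..<m}"]) auto
  next
    fix \<epsilon> :: real assume "0 < \<epsilon>"
    then obtain w \<delta> where w: "0 < w" and \<delta>: "0 \<le> \<delta>" "\<delta> * (N / w + (real m - N) / (w + h)) < 1"
      "w - K * \<delta> \<le> \<epsilon> - c"
      using barrier_optimum[OF N0 NK Km h] unfolding c_def by blast
    obtain Kf where Kf: "sym_inverse_on {0..<m} (shift (\<lambda>i j. - G $$ (i, j)) (- (1 + w))) Kf"
      "(\<Sum>i\<in>{0..<m}. Kf i i) \<le> N / w + (real m - N) / (w + h)"
      using woodbury_initial_inverse[OF A B w rC Mi(1) Mi(3)[unfolded C_def hconcat_gram[OF A B]] G_def _ Nm
          h_def[unfolded \<tau>_def]] r by (auto simp: N_def)
    have "pos_def_on {0..<m} (shift (\<lambda>i j. - G $$ (i, j)) (- (1 + w)))"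
      using w by (intro whitened_gram_pos_def[OF A B Mi(1) Mi(2)[unfolded C_def] Mi(4) G_def]) simp
    then obtain T where T: "T \<subseteq> {0..<m}" "card T = card {0..<m} - k"
      "pos_def_on T (shift (shift (\<lambda>i j. - G $$ (i, j)) (- (1 + w))) ((real k + 1) * \<delta>))"
      using km by (auto intro: restricted_pos_def_subset[OF finite_atLeastLessThan _ Kf \<delta>(1,2), of k])
    have eq: "shift (shift (\<lambda>i j. - G $$ (i, j)) (- (1 + w))) ((real k + 1) * \<delta>)
        = shift (\<lambda>i j. - G $$ (i, j)) (- (1 + w - K * \<delta>))"
      by (intro ext) (simp add: K_def algebra_simps)
    have "T \<noteq> {}" using T(2) km by auto
    have "good T \<epsilon>"
      unfolding good_def
    proof
      fix y :: "real vec" assume y: "y \<in> carrier_vec n"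
      have "(\<Sum>j\<in>T. ((transpose_mat B *\<^sub>v y) $ j)\<^sup>2)
          \<le> (1 + w - K * \<delta>) * ((transpose_mat C *\<^sub>v y) \<bullet> (transpose_mat C *\<^sub>v y))"
        by (rule restricted_column_norm_le[OF C B Mi(1,2) G_def T(1) \<open>T \<noteq> {}\<close> T(3)[unfolded eq] y])
      also have "\<dots> \<le> (1 - c + \<epsilon>) * ((transpose_mat C *\<^sub>v y) \<bullet> (transpose_mat C *\<^sub>v y))"
        using \<delta>(3) by (intro mult_right_mono real_scalar_prod_self) auto
      finally show "(\<Sum>j\<in>T. ((transpose_mat B *\<^sub>v y) $ j)\<^sup>2)
          \<le> (1 - c + \<epsilon>) * ((transpose_mat C *\<^sub>v y) \<bullet> (transpose_mat C *\<^sub>v y))" .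
    qed
    with T show "\<exists>T\<in>{T. T \<subseteq> {0..<m} \<and> card T = m - k}. good T \<epsilon>" by auto
  next
    fix T and \<epsilon> \<epsilon>' :: real assume g: "good T \<epsilon>" and "\<epsilon> \<le> \<epsilon>'"
    then have "(1 - c + \<epsilon>) * ((transpose_mat C *\<^sub>v y) \<bullet> (transpose_mat C *\<^sub>v y))
        \<le> (1 - c + \<epsilon>') * ((transpose_mat C *\<^sub>v y) \<bullet> (transpose_mat C *\<^sub>v y))" for y :: "real vec"
      by (intro mult_right_mono real_scalar_prod_self) auto
    with g show "good T \<epsilon>'" unfolding good_def by (meson order_trans)
  qed
  then obtain T where T: "T \<subseteq> {0..<m}" "card T = m - k" and good: "\<And>\<epsilon>. 0 < \<epsilon> \<Longrightarrow> good T \<epsilon>" by auto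
  \<comment> \<open>The \<open>k\<close> indices deleted by the barrier argument become the selected
    columns.\<close>
  define S where "S = {0..<m} - T"
  have S: "S \<subseteq> {0..<m}" by (auto simp: S_def)
  have "card S = k" using T km by (simp add: S_def card_Diff_subset finite_subset)
  define Q where "Q = hconcat A (col_submatrix B S)"
  note BS = col_submatrix_carrier[OF B S]
  have Q: "Q \<in> carrier_mat n (l + card S)" unfolding Q_def by (rule hconcat_carrier[OF A BS])
  have le: "c * ((transpose_mat C *\<^sub>v y) \<bullet> (transpose_mat C *\<^sub>v y)) \<le> (transpose_mat Q *\<^sub>v y) \<bullet> (transpose_mat Q *\<^sub>v y)"
    if y: "y \<in> carrier_vec n" for y :: "real vec"
  proof -
    define q where "q = (transpose_mat C *\<^sub>v y) \<bullet> (transpose_mat C *\<^sub>v y)"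
    define b where "b j = ((transpose_mat B *\<^sub>v y) $ j)\<^sup>2" for j
    have q0: "0 \<le> q" unfolding q_def by (rule real_scalar_prod_self)
    have "sum b T \<le> (1 - c) * q"
    proof (rule field_le_epsilon)
      fix e :: real assume e: "0 < e"
      \<comment> \<open>Dividing by \<open>q + 1\<close> instead of \<open>q\<close> covers
        \<open>q = 0\<close>, and the excess stays at most \<open>e\<close>.\<close>
      have "sum b T \<le> (1 - c + e / (q + 1)) * q"
        using good[of "e / (q + 1)"] e q0 y by (simp add: good_def b_def q_def)
      also have "\<dots> \<le> (1 - c) * q + e" using e q0 by (simp add: field_simps)
      finally show "sum b T \<le> (1 - c) * q + e" .
    qed
    moreover have "(transpose_mat B *\<^sub>v y) \<bullet> (transpose_mat B *\<^sub>v y) = sum b S + sum b T"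
    proof -
      have "(transpose_mat B *\<^sub>v y) \<bullet> (transpose_mat B *\<^sub>v y) = sum b {0..<m}"
        using B by (simp add: scalar_prod_def[of "transpose_mat B *\<^sub>v y"] b_def power2_eq_square)
      then show ?thesis using sum.subset_diff[OF T(1), of b] by (simp add: S_def)
    qed
    moreover have "q = (transpose_mat A *\<^sub>v y) \<bullet> (transpose_mat A *\<^sub>v y) + (transpose_mat B *\<^sub>v y) \<bullet> (transpose_mat B *\<^sub>v y)"
      unfolding q_def C_def by (rule hconcat_transpose_mult_norm[OF A B y])
    moreover have "(transpose_mat Q *\<^sub>v y) \<bullet> (transpose_mat Q *\<^sub>v y)
        = (transpose_mat A *\<^sub>v y) \<bullet> (transpose_mat A *\<^sub>v y) + sum b S"
      unfolding Q_def hconcat_transpose_mult_norm[OF A BS y] col_submatrix_transpose_mult_norm[OF B S y]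
      by (simp add: b_def)
    ultimately show ?thesis by (simp add: q_def[symmetric] algebra_simps)
  qed
  have "1 / c = Gamma_bound m n k r * (1 + \<tau>)"
    by (simp add: c_def h_def Gamma_bound_def K_def N_def algebra_simps)
  moreover have "\<tau> = (frobenius_norm (pseudoinverse A * B))\<^sup>2 / (real m - real n + real r)"
    by (simp add: \<tau>_def N_def algebra_simps)
  ultimately show ?thesis
    using pseudoinverse_norm_comparison[OF Q C c rC[folded C_def] le] S \<open>card S = k\<close>
    unfolding Q_def C_def by (intro exI[of _ S]) simp
qed

end
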